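(* Let $n\ge 1$ and let $V$ be an $(n+1)$-dimensional $\mathcal A^*$-stable subspace of $H_w$ containing $\mathbf e^0$, and let $\{\mathbf e^0,\mathbf e^1,\dots,\mathbf e^n\}$ be an orthonormal basis of $(V,\langle\cdot,\cdot\rangle_w)$. Let $\mathbf q=(q_{k0})_{k=1,\dots,n}\in\mathbb R^n$ and $\mathbf Q=(q_{kh})_{k,h=1,\dots,n}\in\mathbb R^{n\times n}$ be such that $$\mathcal A^*\mathbf e^k=q_{k0}\mathbf e^0+\sum_{h=1}^n q_{kh}\mathbf e^h,\qquad k=1,\dots,n$$ (these exist by $\mathcal A^*$-stability of $V$). Suppose that $\boldsymbol\alpha,\boldsymbol\beta\in V$. Let $\mathbf s=(s_0,s_1)\in H_w$ and $u\in\mathcal U$, let $S$ be the corresponding solution of the delay equation, let $\mathbf X_t=(S_t,(S_{t+\xi})_{\xi\in\mathbb R^-})$, and set, for $k=0,\dots,n$, $$X^k_t=\langle\mathbf e^k,\mathbf X_t\rangle_w,\quad \alpha^k=\langle\mathbf e^k,\boldsymbol\alpha\rangle_w,\quad \beta^k=\langle\mathbf e^k,\boldsymbol\beta\rangle_w,\quad \gamma^k=\langle\mathbf e^k,\boldsymbol\gamma\rangle_w .$$ Then $X^0=S$ and $(X^0,X^1,\dots,X^n)$ solves the $(n+1)$-dimensional (Markovian) controlled stochastic differential system $$dX^0_t=b\Big(X^0_t,\sum_{k=1}^n\alpha^kX^k_t,u_t\Big)dt+\sigma\Big(X^0_t,\sum_{k=1}^n\beta^kX^k_t,u_t\Big)dW_t,$$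 $$dX^k_t=\Big(q_{k0}X^0_t+\sum_{h=1}^nq_{kh}X^h_t\Big)dt,\qquad k=1,\dots,n,$$ with initial data $X^k_0=\langle\mathbf e^k,\mathbf s\rangle_w$, $k=0,\dots,n$. If, in addition, $\boldsymbol\gamma\in V$, then $$Z_t=\sum_{k=0}^n\gamma^kX^k_t,\qquad t\ge 0.$$
   Context: Setting. $(\Omega,\mathcal F,\mathbb P)$ is a complete probability space carrying a one-dimensional Brownian motion $W=(W_t)_{t\ge0}$; $\mathbb F=(\mathcal F_t)_{t\ge0}$ is the filtration generated by $W$ and enlarged by the $\mathbb P$-null sets. $\mathbb R^-=(-\infty,0]$. Weight: $w\in C^1(\mathbb R^-;\mathbb R)$, $w>0$, $w'/w$ bounded, $w(0)=1$. $L^2_w:=L^2(\mathbb R^-,w(\xi)d\xi;\mathbb R)$, and $H_w:=\mathbb R\times L^2_w$ with inner product $\langle\mathbf x,\mathbf y\rangle_w=x_0y_0+\int_{\mathbb R^-}x_1(\xi)y_1(\xi)w(\xi)d\xi$ and norm $\|\cdot\|_w$. Coefficients: $U\subset\mathbb R^d$; $\mathcal U$ is the set of adapted processes $(u_t)_{t\ge0}$ belonging to $L^2_{loc}(\mathbb R^+;L^2(\Omega;U))$; $b,\sigma:\mathbb R^2\times U\to\mathbb R$ are Borel measurable and there are constants $C_1,C_2\ge0$ with $|b(x,y,u)-b(x',y',u)|+|\sigma(x,y,u)-\sigma(x',y',u)|\le C_1(|x-x'|+|y-y'|)$ and $|b(x,y,u)|+|\sigma(x,y,u)|\le C_2(1+|x|+|y|)$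 for all $x,x',y,y'\in\mathbb R$, $u\in U$. $\alpha_1,\beta_1,\gamma_1\in L^2_w$ and $\gamma_0\in\mathbb R$ are given. Put $\mathbf e^0=(1,0)$, $\boldsymbol\alpha=(0,\alpha_1)$, $\boldsymbol\beta=(0,\beta_1)$, $\boldsymbol\gamma=(\gamma_0,\gamma_1)$, all in $H_w$. For $\mathbf s=(s_0,s_1)\in H_w$ and $u\in\mathcal U$, $S$ denotes the unique (continuous on $[0,\infty)$) strong solution of $$dS_t=b\Big(S_t,\int_{\mathbb R^-}\alpha_1(\xi)S_{t+\xi}w(\xi)d\xi,u_t\Big)dt+\sigma\Big(S_t,\int_{\mathbb R^-}\beta_1(\xi)S_{t+\xi}w(\xi)d\xi,u_t\Big)dW_t,$$ with $S_0=s_0$ and $S_\xi=s_1(\xi)$ for $\xi<0$, and $Z_t=\gamma_0S_t+\int_{\mathbb R^-}\gamma_1(\xi)S_{t+\xi}w(\xi)d\xi$. $W^{1,2}_w$ is the space of (locally absolutely continuous) $f$ on $\mathbb R^-$ with weak derivative $f'$ such that $\int_{\mathbb R^-}(|f|^2+|f'|^2)w\,d\xi<\infty$. The operator $\mathcal A^*$ on $H_w$ has domain $D(\mathcal A^* )=\{\mathbf x\in H_w: x_1\in W^{1,2}_w\}$ and $\mathcal A^*\mathbf x=\big(x_1(0),-x_1'-x_1\frac{w'}{w}\big)$. A finite-dimensional subspace $V\subset H_w$ is called $\mathcal A^*$-stable if $V\subset D(\mathcal A^* )$ and $\mathcal A^*V\subset V$. *)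

theory Defs
  imports "HOL-Probability.Probability"
begin

section \<open>The weighted Hilbert space\<close>

text \<open>Functions on the half line \<open>{..0}\<close> are represented by total functions whose values at
  positive arguments are never used. One-sided derivatives are taken at the end point \<open>0\<close>.\<close>

definition wder :: "(real \<Rightarrow> real) \<Rightarrow> real \<Rightarrow> real" where
  "wder w \<xi> = vector_derivative w (at \<xi> within {..0})"

definition weight :: "(real \<Rightarrow> real) \<Rightarrow> bool" where
  "weight w \<longleftrightarrow>
     w differentiable_on {..0} \<and> continuous_on {..0} (wder w) \<and>
     (\<forall>\<xi>\<le>0. 0 < w \<xi>) \<and> bounded ((\<lambda>\<xi>. wder w \<xi> / w \<xi>) ` {..0}) \<and> w 0 = 1"

text \<open>Elements of the weighted spaces are given by Borel representatives (every class of Lebesgue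
  measurable functions has one); equality in the space is \<open>Hw_eq\<close>. Since \<open>w > 0\<close>, null sets of
  \<open>w(\<xi>)d\<xi>\<close> and of Lebesgue measure coincide.\<close>

definition L2w :: "(real \<Rightarrow> real) \<Rightarrow> (real \<Rightarrow> real) set" where
  "L2w w = {f. set_borel_measurable lborel {..0} f \<and>
               set_integrable lborel {..0} (\<lambda>\<xi>. (f \<xi>)\<^sup>2 * w \<xi>)}"

definition L2w_inner :: "(real \<Rightarrow> real) \<Rightarrow> (real \<Rightarrow> real) \<Rightarrow> (real \<Rightarrow> real) \<Rightarrow> real" where
  "L2w_inner w f g = (LINT \<xi>:{..0}|lborel. f \<xi> * g \<xi> * w \<xi>)"

type_synonym hw = "real \<times> (real \<Rightarrow> real)"

definition Hw :: "(real \<Rightarrow> real) \<Rightarrow> hw set" where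
  "Hw w = UNIV \<times> L2w w"

definition Hw_inner :: "(real \<Rightarrow> real) \<Rightarrow> hw \<Rightarrow> hw \<Rightarrow> real" where
  "Hw_inner w x y = fst x * fst y + L2w_inner w (snd x) (snd y)"

definition ae_eq :: "(real \<Rightarrow> real) \<Rightarrow> (real \<Rightarrow> real) \<Rightarrow> bool" where
  "ae_eq f g \<longleftrightarrow> (AE \<xi> in lborel. \<xi> \<le> 0 \<longrightarrow> f \<xi> = g \<xi>)"

definition Hw_eq :: "hw \<Rightarrow> hw \<Rightarrow> bool" where
  "Hw_eq x y \<longleftrightarrow> fst x = fst y \<and> ae_eq (snd x) (snd y)"

definition Hw_lincomb :: "'i set \<Rightarrow> ('i \<Rightarrow> real) \<Rightarrow> ('i \<Rightarrow> hw) \<Rightarrow> hw" where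
  "Hw_lincomb I c v = (\<Sum>i\<in>I. c i * fst (v i), \<lambda>\<xi>. \<Sum>i\<in>I. c i * snd (v i) \<xi>)"

definition e0 :: hw where
  "e0 = (1, \<lambda>_. 0)"

text \<open>A subspace is given by the set of all representatives of its elements, hence the closure
  under \<open>Hw_eq\<close>.\<close>

definition Hw_subspace :: "(real \<Rightarrow> real) \<Rightarrow> hw set \<Rightarrow> bool" where
  "Hw_subspace w V \<longleftrightarrow>
     V \<subseteq> Hw w \<and> (0, \<lambda>_. 0) \<in> V \<and>
     (\<forall>x\<in>V. \<forall>y\<in>V. (fst x + fst y, \<lambda>\<xi>. snd x \<xi> + snd y \<xi>) \<in> V) \<and>
     (\<forall>c. \<forall>x\<in>V. (c * fst x, \<lambda>\<xi>. c * snd x \<xi>) \<in> V) \<and>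
     (\<forall>x\<in>V. \<forall>y\<in>Hw w. Hw_eq x y \<longrightarrow> y \<in> V)"

definition Hw_has_dim :: "hw set \<Rightarrow> nat \<Rightarrow> bool" where
  "Hw_has_dim V m \<longleftrightarrow>
     (\<exists>v. (\<forall>i<m. v i \<in> V) \<and>
          (\<forall>c. Hw_eq (Hw_lincomb {..<m} c v) (0, \<lambda>_. 0) \<longrightarrow> (\<forall>i<m. c i = 0)) \<and>
          (\<forall>x\<in>V. \<exists>c. Hw_eq x (Hw_lincomb {..<m} c v)))"

definition Hw_orthonormal_basis :: "(real \<Rightarrow> real) \<Rightarrow> hw set \<Rightarrow> nat set \<Rightarrow> (nat \<Rightarrow> hw) \<Rightarrow> bool" where
  "Hw_orthonormal_basis w V I e \<longleftrightarrow>
     (\<forall>i\<in>I. e i \<in> V) \<and>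
     (\<forall>i\<in>I. \<forall>j\<in>I. Hw_inner w (e i) (e j) = (if i = j then 1 else 0)) \<and>
     (\<forall>x\<in>V. \<exists>c. Hw_eq x (Hw_lincomb I c e))"


section \<open>The operator \<open>A*\<close>\<close>

definition locally_abs_cont :: "(real \<Rightarrow> real) \<Rightarrow> bool" where
  "locally_abs_cont f \<longleftrightarrow>
     (\<forall>a\<le>0. \<forall>\<epsilon>>0. \<exists>\<delta>>0. \<forall>D. finite D \<and>
        (\<forall>(x, y)\<in>D. a \<le> x \<and> x < y \<and> y \<le> 0) \<and>
        pairwise (\<lambda>(x, y) (x', y'). {x<..<y} \<inter> {x'<..<y'} = {}) D \<and>
        (\<Sum>(x, y)\<in>D. y - x) < \<delta>
        \<longrightarrow> (\<Sum>(x, y)\<in>D. \<bar>f y - f x\<bar>) < \<epsilon>)"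

text \<open>Test functions are continuously differentiable with compact support in the open half line.\<close>

definition weak_derivative :: "(real \<Rightarrow> real) \<Rightarrow> (real \<Rightarrow> real) \<Rightarrow> bool" where
  "weak_derivative f g \<longleftrightarrow>
     (\<forall>\<phi> \<phi>'. (\<forall>x. (\<phi> has_real_derivative \<phi>' x) (at x)) \<and> continuous_on UNIV \<phi>' \<and>
        (\<exists>a b. b < 0 \<and> (\<forall>x. x \<notin> {a..b} \<longrightarrow> \<phi> x = 0))
        \<longrightarrow> (LINT \<xi>:{..0}|lborel. f \<xi> * \<phi>' \<xi>) = - (LINT \<xi>:{..0}|lborel. g \<xi> * \<phi> \<xi>))"

text \<open>\<open>W12_rep w h f g\<close>: the class of \<open>h\<close> in \<open>L2w w\<close> lies in the Sobolev space, with locally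
  absolutely continuous representative \<open>f\<close> and weak derivative \<open>g\<close>. These determine \<open>f\<close> uniquely
  on \<open>{..0}\<close> and \<open>g\<close> up to null sets, so the choice in \<open>Astar\<close> does not matter up to \<open>Hw_eq\<close>.\<close>

definition W12_rep :: "(real \<Rightarrow> real) \<Rightarrow> (real \<Rightarrow> real) \<Rightarrow> (real \<Rightarrow> real) \<Rightarrow> (real \<Rightarrow> real) \<Rightarrow> bool" where
  "W12_rep w h f g \<longleftrightarrow>
     ae_eq h f \<and> locally_abs_cont f \<and> f \<in> L2w w \<and> g \<in> L2w w \<and> weak_derivative f g"

definition Astar_dom :: "(real \<Rightarrow> real) \<Rightarrow> hw set" where
  "Astar_dom w = {x \<in> Hw w. \<exists>f g. W12_rep w (snd x) f g}"

definition Astar :: "(real \<Rightarrow> real) \<Rightarrow> hw \<Rightarrow> hw" where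
  "Astar w x = (let (f, g) = (SOME (f, g). W12_rep w (snd x) f g)
                in (f 0, \<lambda>\<xi>. - g \<xi> - f \<xi> * (wder w \<xi> / w \<xi>)))"

definition Astar_stable :: "(real \<Rightarrow> real) \<Rightarrow> hw set \<Rightarrow> bool" where
  "Astar_stable w V \<longleftrightarrow> V \<subseteq> Astar_dom w \<and> Astar w ` V \<subseteq> V"


section \<open>Brownian motion, Ito integral and Ito differentials\<close>

definition brownian_motion :: "'a measure \<Rightarrow> (real \<Rightarrow> 'a \<Rightarrow> real) \<Rightarrow> bool" where
  "brownian_motion M W \<longleftrightarrow>
     (\<forall>t\<ge>0. W t \<in> borel_measurable M) \<and>
     (AE \<omega> in M. W 0 \<omega> = 0) \<and>
     (AE \<omega> in M. continuous_on {0..} (\<lambda>t. W t \<omega>)) \<and>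
     (\<forall>s t. 0 \<le> s \<and> s < t \<longrightarrow>
        distributed M lborel (\<lambda>\<omega>. W t \<omega> - W s \<omega>) (\<lambda>x. ennreal (normal_density 0 (sqrt (t - s)) x))) \<and>
     (\<forall>(\<tau> :: nat \<Rightarrow> real) m. 0 \<le> \<tau> 0 \<and> incseq \<tau> \<longrightarrow>
        prob_space.indep_vars M (\<lambda>_. borel) (\<lambda>i \<omega>. W (\<tau> (Suc i)) \<omega> - W (\<tau> i) \<omega>) {..<m})"

definition brownian_filtration :: "'a measure \<Rightarrow> (real \<Rightarrow> 'a \<Rightarrow> real) \<Rightarrow> real \<Rightarrow> 'a measure" where
  "brownian_filtration M W t =
     sigma (space M)
       ({W s -` A \<inter> space M | s A. 0 \<le> s \<and> s \<le> t \<and> A \<in> sets borel} \<union> null_sets M)"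

text \<open>Jointly measurable adapted processes on the time set \<open>{0..}\<close>.\<close>

definition measurable_adapted ::
    "'a measure \<Rightarrow> (real \<Rightarrow> 'a \<Rightarrow> real) \<Rightarrow> (real \<Rightarrow> 'a \<Rightarrow> 'b::topological_space) \<Rightarrow> bool" where
  "measurable_adapted M W H \<longleftrightarrow>
     (\<lambda>(t, \<omega>). H t \<omega>) \<in> borel_measurable (restrict_space borel {0..} \<Otimes>\<^sub>M M) \<and>
     (\<forall>t\<ge>0. H t \<in> borel_measurable (brownian_filtration M W t))"

definition conv_in_prob :: "'a measure \<Rightarrow> (nat \<Rightarrow> 'a \<Rightarrow> real) \<Rightarrow> ('a \<Rightarrow> real) \<Rightarrow> bool" where
  "conv_in_prob M Y Z \<longleftrightarrow>
     (\<forall>\<epsilon>>0. (\<lambda>j. measure M {\<omega> \<in> space M. \<epsilon> < \<bar>Y j \<omega> - Z \<omega>\<bar>}) \<longlonglongrightarrow> 0)"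

text \<open>Simple integrands \<open>\<Sum>i<m. \<xi>\<^sub>i 1\<^bsub>(\<tau>\<^sub>i, \<tau>\<^sub>i\<^sub>+\<^sub>1]\<^esub>\<close>, encoded by \<open>(m, \<tau>, \<xi>)\<close>, and their integrals.\<close>

type_synonym 'a simple_process = "nat \<times> (nat \<Rightarrow> real) \<times> (nat \<Rightarrow> 'a \<Rightarrow> real)"

definition is_simple_process ::
    "'a measure \<Rightarrow> (real \<Rightarrow> 'a \<Rightarrow> real) \<Rightarrow> 'a simple_process \<Rightarrow> bool" where
  "is_simple_process M W P \<longleftrightarrow> (case P of (m, \<tau>, \<xi>) \<Rightarrow>
     0 \<le> \<tau> 0 \<and> (\<forall>i<m. \<tau> i < \<tau> (Suc i)) \<and>
     (\<forall>i<m. \<xi> i \<in> borel_measurable (brownian_filtration M W (\<tau> i))) \<and>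
     (\<exists>C. \<forall>i<m. \<forall>\<omega>\<in>space M. \<bar>\<xi> i \<omega>\<bar> \<le> C))"

definition simple_process_at :: "'a simple_process \<Rightarrow> real \<Rightarrow> 'a \<Rightarrow> real" where
  "simple_process_at P t \<omega> = (case P of (m, \<tau>, \<xi>) \<Rightarrow>
     (\<Sum>i<m. \<xi> i \<omega> * indicator {\<tau> i<..\<tau> (Suc i)} t))"

definition simple_integral_at ::
    "(real \<Rightarrow> 'a \<Rightarrow> real) \<Rightarrow> 'a simple_process \<Rightarrow> real \<Rightarrow> 'a \<Rightarrow> real" where
  "simple_integral_at W P t \<omega> = (case P of (m, \<tau>, \<xi>) \<Rightarrow>
     (\<Sum>i<m. \<xi> i \<omega> * (W (min (\<tau> (Suc i)) t) \<omega> - W (min (\<tau> i) t) \<omega>)))"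

text \<open>\<open>I\<close> is (a version of) the Ito integral process of \<open>H\<close>, for measurable adapted \<open>H\<close> that is
  almost surely locally square integrable in time: a continuous adapted process which at each time
  \<open>t\<close> is the limit in probability of integrals of simple processes converging to \<open>H\<close> in
  \<open>L\<^sup>2([0,t])\<close> in probability. This determines \<open>I\<close> up to indistinguishability.\<close>

definition is_ito_integral ::
    "'a measure \<Rightarrow> (real \<Rightarrow> 'a \<Rightarrow> real) \<Rightarrow> (real \<Rightarrow> 'a \<Rightarrow> real) \<Rightarrow> (real \<Rightarrow> 'a \<Rightarrow> real) \<Rightarrow> bool" where
  "is_ito_integral M W H I \<longleftrightarrow>
     measurable_adapted M W H \<and>
     (AE \<omega> in M. \<forall>T\<ge>0. set_integrable lborel {0..T} (\<lambda>t. (H t \<omega>)\<^sup>2)) \<and>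
     (\<forall>t\<ge>0. I t \<in> borel_measurable (brownian_filtration M W t)) \<and>
     (AE \<omega> in M. continuous_on {0..} (\<lambda>t. I t \<omega>)) \<and>
     (\<forall>t\<ge>0. \<exists>P. (\<forall>j. is_simple_process M W (P j)) \<and>
        conv_in_prob M
          (\<lambda>j \<omega>. LINT s:{0..t}|lborel. (simple_process_at (P j) s \<omega> - H s \<omega>)\<^sup>2) (\<lambda>_. 0) \<and>
        conv_in_prob M (\<lambda>j. simple_integral_at W (P j) t) (I t))"

text \<open>\<open>dX = B dt + H dW\<close> on \<open>{0..}\<close>, for a continuous adapted process \<open>X\<close>.\<close>

definition has_ito_differential ::
    "'a measure \<Rightarrow> (real \<Rightarrow> 'a \<Rightarrow> real) \<Rightarrow> (real \<Rightarrow> 'a \<Rightarrow> real) \<Rightarrow>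
     (real \<Rightarrow> 'a \<Rightarrow> real) \<Rightarrow> (real \<Rightarrow> 'a \<Rightarrow> real) \<Rightarrow> bool" where
  "has_ito_differential M W X B H \<longleftrightarrow>
     (\<forall>t\<ge>0. X t \<in> borel_measurable (brownian_filtration M W t)) \<and>
     (\<forall>\<omega>\<in>space M. continuous_on {0..} (\<lambda>t. X t \<omega>)) \<and>
     measurable_adapted M W B \<and>
     (AE \<omega> in M. \<forall>T\<ge>0. set_integrable lborel {0..T} (\<lambda>t. B t \<omega>)) \<and>
     (\<exists>I. is_ito_integral M W H I \<and>
        (AE \<omega> in M. \<forall>t\<ge>0. X t \<omega> = X 0 \<omega> + (LINT s:{0..t}|lborel. B s \<omega>) + I t \<omega>))"


section \<open>The controlled delay equation\<close>

definition control_process ::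
    "'a measure \<Rightarrow> (real \<Rightarrow> 'a \<Rightarrow> real) \<Rightarrow> (real ^ 'd) set \<Rightarrow> (real \<Rightarrow> 'a \<Rightarrow> real ^ 'd) \<Rightarrow> bool" where
  "control_process M W U u \<longleftrightarrow>
     measurable_adapted M W u \<and> (\<forall>t\<ge>0. \<forall>\<omega>\<in>space M. u t \<omega> \<in> U) \<and>
     (\<forall>T\<ge>0. (\<integral>\<^sup>+t\<in>{0..T}. (\<integral>\<^sup>+\<omega>. ennreal ((norm (u t \<omega>))\<^sup>2) \<partial>M) \<partial>lborel) < \<infinity>)"

definition coefficients ::
    "(real ^ 'd) set \<Rightarrow> (real \<Rightarrow> real \<Rightarrow> real ^ 'd \<Rightarrow> real) \<Rightarrow>
     (real \<Rightarrow> real \<Rightarrow> real ^ 'd \<Rightarrow> real) \<Rightarrow> bool" where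
  "coefficients U b \<sigma> \<longleftrightarrow>
     (\<lambda>(x, y, v). b x y v) \<in> borel_measurable (restrict_space borel (UNIV \<times> UNIV \<times> U)) \<and>
     (\<lambda>(x, y, v). \<sigma> x y v) \<in> borel_measurable (restrict_space borel (UNIV \<times> UNIV \<times> U)) \<and>
     (\<exists>C1\<ge>0. \<forall>x x' y y'. \<forall>v\<in>U.
        \<bar>b x y v - b x' y' v\<bar> + \<bar>\<sigma> x y v - \<sigma> x' y' v\<bar> \<le> C1 * (\<bar>x - x'\<bar> + \<bar>y - y'\<bar>)) \<and>
     (\<exists>C2\<ge>0. \<forall>x y. \<forall>v\<in>U. \<bar>b x y v\<bar> + \<bar>\<sigma> x y v\<bar> \<le> C2 * (1 + \<bar>x\<bar> + \<bar>y\<bar>))"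

text \<open>The past \<open>s\<^sub>1\<close> is a fixed Borel representative; changing it on a null set does not affect the
  equation.\<close>

definition delay_solution ::
    "'a measure \<Rightarrow> (real \<Rightarrow> 'a \<Rightarrow> real) \<Rightarrow> (real \<Rightarrow> real) \<Rightarrow>
     (real \<Rightarrow> real \<Rightarrow> real ^ 'd \<Rightarrow> real) \<Rightarrow> (real \<Rightarrow> real \<Rightarrow> real ^ 'd \<Rightarrow> real) \<Rightarrow>
     (real \<Rightarrow> real) \<Rightarrow> (real \<Rightarrow> real) \<Rightarrow> hw \<Rightarrow> (real \<Rightarrow> 'a \<Rightarrow> real ^ 'd) \<Rightarrow>
     (real \<Rightarrow> 'a \<Rightarrow> real) \<Rightarrow> bool" where
  "delay_solution M W w b \<sigma> \<alpha>1 \<beta>1 s u S \<longleftrightarrow>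
     (\<forall>\<omega>\<in>space M. S 0 \<omega> = fst s \<and> (\<forall>\<xi><0. S \<xi> \<omega> = snd s \<xi>)) \<and>
     has_ito_differential M W S
       (\<lambda>t \<omega>. b (S t \<omega>) (LINT \<xi>:{..0}|lborel. \<alpha>1 \<xi> * S (t + \<xi>) \<omega> * w \<xi>) (u t \<omega>))
       (\<lambda>t \<omega>. \<sigma> (S t \<omega>) (LINT \<xi>:{..0}|lborel. \<beta>1 \<xi> * S (t + \<xi>) \<omega> * w \<xi>) (u t \<omega>))"

definition segment :: "(real \<Rightarrow> 'a \<Rightarrow> real) \<Rightarrow> real \<Rightarrow> 'a \<Rightarrow> hw" where
  "segment S t \<omega> = (S t \<omega>, \<lambda>\<xi>. S (t + \<xi>) \<omega>)"

end

theory Submission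
  imports Defs
begin

text \<open>The statement is pathwise. For \<open>k \<ge> 1\<close> one has \<open>X\<^sup>k\<^sub>t = \<integral> \<phi>\<^sub>k(\<xi>) S\<^sub>t\<^sub>+\<^sub>\<xi> d\<xi>\<close> with \<open>\<phi>\<^sub>k = e\<^sup>k\<^sub>1 w\<close>, and stability
  of \<open>V\<close> says that \<open>\<phi>\<^sub>k' = - \<Sum>\<^sub>h q\<^sub>k\<^sub>h \<phi>\<^sub>h\<close>, \<open>\<phi>\<^sub>k(0) = q\<^sub>k\<^sub>0\<close>. Differentiating the convolution in \<open>t\<close>
  gives the finite-dimensional system, and orthonormal expansion of \<open>\<alpha>\<close>, \<open>\<beta>\<close>, \<open>\<gamma>\<close> in \<open>V\<close> expresses
  the delay terms through the \<open>X\<^sup>k\<close>.\<close>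


section \<open>Filtration and Ito differentials\<close>

text \<open>For \<open>k >= 1\<close> the component has no diffusion part: its Ito integral is the
  zero process, which leaves, besides adaptedness, an integral identity for each single path. Two
  obstacles shape its proof. The past of the path is merely square integrable, so the path itself
  cannot be differentiated in \<open>t\<close>; Fubini moves the derivative onto
  \<open>\<phi>\<close> and is used with a classical derivative of \<open>\<phi>\<close> and a bound
  on the pairings that is uniform on compact time intervals. The uniform bound comes from the
  boundedness of \<open>w'/w\<close>: shifting the past by \<open>t\<close> costs at most a factor
  \<open>exp (K * t)\<close> in the weight. The classical derivative is not given, because basis
  elements are known up to null sets and \<open>Astar\<close> acts through chosen representatives;
  stability identifies the weak derivative almost everywhere with a continuous function, and that
  upgrades it to a classical one. The index 0 is absent from the derivative relation because
  \<open>e0\<close> has zero second component, and it alone fixes the boundary value because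
  orthogonality to \<open>e0\<close> kills the first component of the other basis vectors.\<close>

lemma space_brownian_filtration [simp]: "space (brownian_filtration M W t) = space M"
  by (simp add: brownian_filtration_def space_measure_of_conv)

lemma sets_brownian_filtration:
  "sets (brownian_filtration M W t) = sigma_sets (space M)
     ({W s -` A \<inter> space M | s A. 0 \<le> s \<and> s \<le> t \<and> A \<in> sets borel} \<union> null_sets M)"
  unfolding brownian_filtration_def
  by (rule sets_measure_of) (use sets.sets_into_space in \<open>auto dest!: null_setsD2\<close>)

lemma sets_brownian_filtration_mono:
  assumes "s \<le> t"
  shows "sets (brownian_filtration M W s) \<subseteq> sets (brownian_filtration M W t)"
  unfolding sets_brownian_filtration
  by (rule sigma_sets_mono') (use assms in \<open>auto intro: order_trans\<close>)

lemma measurable_brownian_filtration_mono: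
  "Y \<in> measurable (brownian_filtration M W s) N \<Longrightarrow> s \<le> t \<Longrightarrow>
    Y \<in> measurable (brownian_filtration M W t) N"
  using sets_brownian_filtration_mono[of s t M W] by (auto simp: measurable_def)

lemma sets_brownian_filtration_subset:
  assumes "brownian_motion M W"
  shows "sets (brownian_filtration M W t) \<subseteq> sets M"
proof -
  have "W s \<in> borel_measurable M" if "s \<ge> 0" for s
    using assms that by (auto simp: brownian_motion_def)
  then show ?thesis
    unfolding sets_brownian_filtration
    by (intro sets.sigma_sets_subset) (auto intro: measurable_sets)
qed

lemma measurable_brownian_filtration_ambient:
  "Y \<in> measurable (brownian_filtration M W s) N \<Longrightarrow> brownian_motion M W \<Longrightarrow> Y \<in> measurable M N"
  using sets_brownian_filtration_subset[of M W s] by (auto simp: measurable_def)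

text \<open>Time is rounded down to the grid of mesh \<open>1 / Suc i\<close>. Each rounded process
  is jointly measurable because the grid is countable, and path continuity gives pointwise
  convergence.\<close>

lemma borel_measurable_continuous_process:
  fixes Y :: "real \<Rightarrow> 'a \<Rightarrow> real"
  assumes meas: "\<And>t. Y t \<in> borel_measurable N"
    and cont: "\<And>\<omega>. \<omega> \<in> space N \<Longrightarrow> continuous_on UNIV (\<lambda>t. Y t \<omega>)"
  shows "(\<lambda>(t, \<omega>). Y t \<omega>) \<in> borel_measurable (borel \<Otimes>\<^sub>M N)"
proof (rule borel_measurable_LIMSEQ_metric)
  fix i :: nat
  have [measurable]: "(\<lambda>p. Y (real_of_int m / real (Suc i)) (snd p)) \<in> borel_measurable (borel \<Otimes>\<^sub>M N)" for m
    by (rule measurable_compose[OF measurable_snd meas])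
  have "(\<lambda>p. Y (real_of_int \<lfloor>fst p * real (Suc i)\<rfloor> / real (Suc i)) (snd p)) \<in> borel_measurable (borel \<Otimes>\<^sub>M N)"
    by (rule measurable_compose_countable[where g = "\<lambda>p. \<lfloor>fst p * real (Suc i)\<rfloor>"]) measurable
  then show "(\<lambda>(t, \<omega>). Y (real_of_int \<lfloor>t * real (Suc i)\<rfloor> / real (Suc i)) \<omega>) \<in> borel_measurable (borel \<Otimes>\<^sub>M N)"
    by (simp add: case_prod_beta')
next
  fix p :: "real \<times> 'a" assume p: "p \<in> space (borel \<Otimes>\<^sub>M N)"
  obtain t \<omega> where pe: "p = (t, \<omega>)" by force
  have "(\<lambda>i. real_of_int \<lfloor>t * real (Suc i)\<rfloor> / real (Suc i)) \<longlonglongrightarrow> t"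
  proof (rule tendsto_sandwich[of "\<lambda>i. t - 1 / real (Suc i)" _ _ "\<lambda>_. t"])
    show "\<forall>\<^sub>F i in sequentially. t - 1 / real (Suc i) \<le> real_of_int \<lfloor>t * real (Suc i)\<rfloor> / real (Suc i)"
    proof (intro always_eventually allI)
      fix i
      have "t * real (Suc i) - 1 \<le> real_of_int \<lfloor>t * real (Suc i)\<rfloor>" by linarith
      then have "(t * real (Suc i) - 1) / real (Suc i) \<le> real_of_int \<lfloor>t * real (Suc i)\<rfloor> / real (Suc i)"
        by (intro divide_right_mono) auto
      then show "t - 1 / real (Suc i) \<le> real_of_int \<lfloor>t * real (Suc i)\<rfloor> / real (Suc i)"
        by (simp add: diff_divide_distrib)
    qed
    show "\<forall>\<^sub>F i in sequentially. real_of_int \<lfloor>t * real (Suc i)\<rfloor> / real (Suc i) \<le> t"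
      by (intro always_eventually allI) (simp add: divide_le_eq)
    show "(\<lambda>i. t - 1 / real (Suc i)) \<longlonglongrightarrow> t"
      using tendsto_diff[OF tendsto_const[of t] LIMSEQ_Suc[OF lim_1_over_n]] by simp
  qed simp
  moreover have "isCont (\<lambda>t. Y t \<omega>) t"
    using cont[of \<omega>] p pe by (auto simp: space_pair_measure continuous_on_eq_continuous_at)
  ultimately show "(\<lambda>i. (case p of (t, \<omega>) \<Rightarrow> Y (real_of_int \<lfloor>t * real (Suc i)\<rfloor> / real (Suc i)) \<omega>))
      \<longlonglongrightarrow> (case p of (t, \<omega>) \<Rightarrow> Y t \<omega>)"
    unfolding pe prod.case by (rule isCont_tendsto_compose[rotated])
qed

lemma measurable_adapted_continuous:
  fixes Y :: "real \<Rightarrow> 'a \<Rightarrow> real"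
  assumes W: "brownian_motion M W"
    and meas: "\<And>t. t \<ge> 0 \<Longrightarrow> Y t \<in> borel_measurable (brownian_filtration M W t)"
    and cont: "\<And>\<omega>. \<omega> \<in> space M \<Longrightarrow> continuous_on {0..} (\<lambda>t. Y t \<omega>)"
  shows "measurable_adapted M W Y"
proof -
  \<comment> \<open>Freezing the process at its value at time 0 extends it continuously to all real
    times.\<close>
  have "(\<lambda>(t, \<omega>). Y (max 0 t) \<omega>) \<in> borel_measurable (borel \<Otimes>\<^sub>M M)"
  proof (rule borel_measurable_continuous_process)
    show "Y (max 0 t) \<in> borel_measurable M" for t
      by (rule measurable_brownian_filtration_ambient[OF meas W]) simp
    show "continuous_on UNIV (\<lambda>t. Y (max 0 t) \<omega>)" if "\<omega> \<in> space M" for \<omega>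
      by (rule continuous_on_compose2[OF cont[OF that]]) (auto intro!: continuous_intros)
  qed
  moreover have "(\<lambda>p. (fst p, snd p)) \<in> measurable (restrict_space borel {0..} \<Otimes>\<^sub>M M) (borel \<Otimes>\<^sub>M M)"
    by (intro measurable_Pair measurable_snd measurable_compose[OF measurable_fst]
        measurable_restrict_space1) simp
  ultimately have "(\<lambda>p. case (fst p, snd p) of (t, \<omega>) \<Rightarrow> Y (max 0 t) \<omega>)
      \<in> borel_measurable (restrict_space borel {0..} \<Otimes>\<^sub>M M)"
    by (rule measurable_compose[rotated])
  moreover have "(\<lambda>p. case (fst p, snd p) of (t, \<omega>) \<Rightarrow> Y (max 0 t) \<omega>)
        \<in> borel_measurable (restrict_space borel {0..} \<Otimes>\<^sub>M M)
      \<longleftrightarrow> (\<lambda>(t, \<omega>). Y t \<omega>) \<in> borel_measurable (restrict_space borel {0..} \<Otimes>\<^sub>M M)"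
    by (rule measurable_cong) (auto simp: space_pair_measure space_restrict_space max_def)
  ultimately show ?thesis
    using meas by (simp add: measurable_adapted_def)
qed

lemma is_ito_integral_zero: "is_ito_integral M W (\<lambda>t \<omega>. 0) (\<lambda>t \<omega>. 0)"
proof -
  \<comment> \<open>The empty simple process, with \<open>m = 0\<close>: it and its integral are
    empty sums, so both convergences in probability concern sequences that vanish
    identically.\<close>
  let ?P = "\<lambda>_::nat. (0::nat, \<lambda>_::nat. 0::real, \<lambda>(_::nat) (_::'a). 0::real)"
  have "is_simple_process M W (?P j)" for j
    by (simp add: is_simple_process_def)
  moreover have "conv_in_prob M
          (\<lambda>j \<omega>. LINT s:{0..t}|lborel. (simple_process_at (?P j) s \<omega> - 0)\<^sup>2) (\<lambda>_. 0)" for t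
    by (simp add: conv_in_prob_def simple_process_at_def)
  moreover have "conv_in_prob M (\<lambda>j. simple_integral_at W (?P j) t) (\<lambda>_. 0)" for t
    by (simp add: conv_in_prob_def simple_integral_at_def)
  ultimately have "\<exists>P. (\<forall>j. is_simple_process M W (P j)) \<and>
        conv_in_prob M (\<lambda>j \<omega>. LINT s:{0..t}|lborel. (simple_process_at (P j) s \<omega> - 0)\<^sup>2) (\<lambda>_. 0) \<and>
        conv_in_prob M (\<lambda>j. simple_integral_at W (P j) t) (\<lambda>_. 0)" for t
    by (intro exI[of _ ?P] conjI allI)
  then show ?thesis
    by (simp add: is_ito_integral_def measurable_adapted_def set_integrable_def case_prod_beta')
qed

lemma measurable_adapted_cong:
  assumes "\<And>t \<omega>. t \<ge> 0 \<Longrightarrow> \<omega> \<in> space M \<Longrightarrow> H t \<omega> = H' t \<omega>"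
  shows "measurable_adapted M W H \<longleftrightarrow> measurable_adapted M W H'"
proof -
  have "(\<lambda>(t, \<omega>). H t \<omega>) \<in> borel_measurable (restrict_space borel {0..} \<Otimes>\<^sub>M M)
    \<longleftrightarrow> (\<lambda>(t, \<omega>). H' t \<omega>) \<in> borel_measurable (restrict_space borel {0..} \<Otimes>\<^sub>M M)"
    by (rule measurable_cong) (auto simp: space_pair_measure space_restrict_space assms)
  moreover have "H t \<in> borel_measurable (brownian_filtration M W t)
    \<longleftrightarrow> H' t \<in> borel_measurable (brownian_filtration M W t)" if "t \<ge> 0" for t
    by (rule measurable_cong) (simp add: assms that)
  ultimately show ?thesis by (simp add: measurable_adapted_def)
qed

lemma is_ito_integral_cong_integrand:
  assumes "is_ito_integral M W H I"
    and eq: "\<And>t \<omega>. t \<ge> 0 \<Longrightarrow> \<omega> \<in> space M \<Longrightarrow> H t \<omega> = H' t \<omega>"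
  shows "is_ito_integral M W H' I"
proof -
  have "set_integrable lborel {0..T} (\<lambda>t. (H t \<omega>)\<^sup>2) \<longleftrightarrow> set_integrable lborel {0..T} (\<lambda>t. (H' t \<omega>)\<^sup>2)"
    if "\<omega> \<in> space M" for T \<omega>
    by (rule set_integrable_cong) (auto simp: eq that)
  then have "AE \<omega> in M. \<forall>T\<ge>0. set_integrable lborel {0..T} (\<lambda>t. (H' t \<omega>)\<^sup>2)"
    using assms(1) unfolding is_ito_integral_def by (auto elim!: AE_mp)
  moreover have "{\<omega> \<in> space M. \<epsilon> < \<bar>(LINT s:{0..t}|lborel. (simple_process_at P s \<omega> - H s \<omega>)\<^sup>2) - 0\<bar>}
      = {\<omega> \<in> space M. \<epsilon> < \<bar>(LINT s:{0..t}|lborel. (simple_process_at P s \<omega> - H' s \<omega>)\<^sup>2) - 0\<bar>}" for \<epsilon> t P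
  proof (rule Collect_cong, rule conj_cong[OF refl])
    fix \<omega> assume "\<omega> \<in> space M"
    then have "(LINT s:{0..t}|lborel. (simple_process_at P s \<omega> - H s \<omega>)\<^sup>2)
        = (LINT s:{0..t}|lborel. (simple_process_at P s \<omega> - H' s \<omega>)\<^sup>2)"
      by (intro set_lebesgue_integral_cong) (auto simp: eq)
    then show "\<epsilon> < \<bar>(LINT s:{0..t}|lborel. (simple_process_at P s \<omega> - H s \<omega>)\<^sup>2) - 0\<bar>
      \<longleftrightarrow> \<epsilon> < \<bar>(LINT s:{0..t}|lborel. (simple_process_at P s \<omega> - H' s \<omega>)\<^sup>2) - 0\<bar>" by simp
  qed
  ultimately show ?thesis
    using assms(1) measurable_adapted_cong[of M H H' W, OF eq]
    unfolding is_ito_integral_def conv_in_prob_def by simp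
qed

lemma has_ito_differential_cong_coefficients:
  assumes "has_ito_differential M W X B H"
    and B: "\<And>t \<omega>. t \<ge> 0 \<Longrightarrow> \<omega> \<in> space M \<Longrightarrow> B t \<omega> = B' t \<omega>"
    and H: "\<And>t \<omega>. t \<ge> 0 \<Longrightarrow> \<omega> \<in> space M \<Longrightarrow> H t \<omega> = H' t \<omega>"
  shows "has_ito_differential M W X B' H'"
proof -
  have int: "set_integrable lborel {0..T} (\<lambda>t. B t \<omega>) \<longleftrightarrow> set_integrable lborel {0..T} (\<lambda>t. B' t \<omega>)"
    if "\<omega> \<in> space M" for T \<omega>
    by (rule set_integrable_cong) (auto simp: B that)
  have eq: "(LINT s:{0..t}|lborel. B s \<omega>) = (LINT s:{0..t}|lborel. B' s \<omega>)" if "\<omega> \<in> space M" for t \<omega>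
    by (rule set_lebesgue_integral_cong) (auto simp: B that)
  obtain I where I: "is_ito_integral M W H I"
    and X: "AE \<omega> in M. \<forall>t\<ge>0. X t \<omega> = X 0 \<omega> + (LINT s:{0..t}|lborel. B s \<omega>) + I t \<omega>"
    and B_int: "AE \<omega> in M. \<forall>T\<ge>0. set_integrable lborel {0..T} (\<lambda>t. B t \<omega>)"
    using assms(1) unfolding has_ito_differential_def by blast
  have "AE \<omega> in M. \<forall>T\<ge>0. set_integrable lborel {0..T} (\<lambda>t. B' t \<omega>)"
    using B_int AE_space by eventually_elim (simp add: int)
  moreover have "AE \<omega> in M. \<forall>t\<ge>0. X t \<omega> = X 0 \<omega> + (LINT s:{0..t}|lborel. B' s \<omega>) + I t \<omega>"
    using X AE_space by eventually_elim (metis eq)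
  moreover have "is_ito_integral M W H' I"
    by (rule is_ito_integral_cong_integrand[OF I H])
  ultimately show ?thesis
    using assms(1) measurable_adapted_cong[of M B B' W, OF B]
    unfolding has_ito_differential_def by blast
qed


section \<open>The fundamental lemma of the calculus of variations\<close>

lemma continuous_has_antiderivative:
  fixes f :: "real \<Rightarrow> real"
  assumes "continuous_on UNIV f"
  obtains F where "\<And>x. (F has_real_derivative f x) (at x)"
proof -
  have "\<exists>F. \<forall>x :: real. -\<infinity> < ereal x \<longrightarrow> ereal x < \<infinity> \<longrightarrow> (F has_vector_derivative f x) (at x)"
    by (rule einterval_antiderivative) (use assms in \<open>auto simp: continuous_on_eq_continuous_at\<close>)
  then show ?thesis
    using that by (auto simp: has_real_derivative_iff_has_vector_derivative)
qed

lemma set_lebesgue_integral_compact_support: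
  fixes h :: "real \<Rightarrow> real"
  assumes "continuous_on {a..b} h" "{a..b} \<subseteq> S" "\<And>x. x \<notin> {a..b} \<Longrightarrow> h x = 0"
  shows "(LINT x:S|lborel. h x) = integral {a..b} h"
proof -
  have "(LINT x:S|lborel. h x) = (LINT x:{a..b}|lborel. h x)"
    unfolding set_lebesgue_integral_def
    by (rule Bochner_Integration.integral_cong) (use assms(2,3) in \<open>auto simp: indicator_def\<close>)
  then show ?thesis
    using set_borel_integral_eq_integral(2)[OF borel_integrable_atLeastAtMost'[OF assms(1)]] by simp
qed

text \<open>Constant continuation beyond \<open>c\<close> moves functions on the half line to the
  whole line, where two-sided antiderivatives are at hand.\<close>

lemma continuous_on_atMost_extend:
  fixes f :: "real \<Rightarrow> real"
  assumes "continuous_on {..c} f"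
  shows "continuous_on UNIV (\<lambda>x. f (min x c))"
  by (rule continuous_on_compose2[OF assms]) (auto intro!: continuous_intros)

text \<open>For a continuous function the fundamental lemma needs no mollification: test against
  \<open>(D - c) \<rho>\<close>, where \<open>\<rho>\<close> is a continuous bump on \<open>[a, b]\<close> and \<open>c\<close> is the \<open>\<rho>\<close>-mean of \<open>D\<close>.\<close>

lemma du_Bois_Reymond_continuous:
  fixes D :: "real \<Rightarrow> real"
  assumes D: "continuous_on UNIV D" and "a < b"
    and test: "\<And>\<phi> \<phi>'. (\<And>x. (\<phi> has_real_derivative \<phi>' x) (at x)) \<Longrightarrow> continuous_on UNIV \<phi>' \<Longrightarrow>
      (\<And>x. x \<notin> {a..b} \<Longrightarrow> \<phi> x = 0) \<Longrightarrow> (\<And>x. x \<notin> {a..b} \<Longrightarrow> \<phi>' x = 0) \<Longrightarrow>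
      integral {a..b} (\<lambda>x. D x * \<phi>' x) = 0"
  shows "\<exists>c. \<forall>x\<in>{a<..<b}. D x = c"
proof -
  define \<rho> where "\<rho> = (\<lambda>x. max 0 ((x - a) * (b - x)))"
  have cont_\<rho>: "continuous_on X \<rho>" for X
    unfolding \<rho>_def by (intro continuous_intros)
  have cont_D: "continuous_on X D" for X
    using D by (rule continuous_on_subset) simp
  have \<rho>_nonneg: "\<rho> x \<ge> 0" for x by (simp add: \<rho>_def)
  have \<rho>_pos: "\<rho> x > 0" if "x \<in> {a<..<b}" for x
    using that by (simp add: \<rho>_def less_max_iff_disj)
  have \<rho>_zero: "\<rho> x = 0" if "x \<notin> {a<..<b}" for x
    using that \<open>a < b\<close> by (auto simp: \<rho>_def max_def zero_le_mult_iff not_less)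
  have "integral {a..b} \<rho> \<noteq> 0"
  proof
    assume "integral {a..b} \<rho> = 0"
    then have "\<rho> ((a + b) / 2) = 0"
      using integral_eq_0_iff[OF cont_\<rho> \<open>a < b\<close> \<rho>_nonneg] \<open>a < b\<close> by auto
    with \<rho>_pos[of "(a + b) / 2"] \<open>a < b\<close> show False by simp
  qed
  define c where "c = integral {a..b} (\<lambda>x. D x * \<rho> x) / integral {a..b} \<rho>"
  define \<eta> where "\<eta> = (\<lambda>x. (D x - c) * \<rho> x)"
  have cont_\<eta>: "continuous_on X \<eta>" for X
    unfolding \<eta>_def by (intro continuous_intros cont_D cont_\<rho>)
  have "integral {a..b} \<eta> = integral {a..b} (\<lambda>x. D x * \<rho> x) - integral {a..b} (\<lambda>x. c * \<rho> x)"
    unfolding \<eta>_def left_diff_distrib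
    by (intro integral_diff integrable_continuous_real continuous_intros cont_D cont_\<rho>)
  then have mean: "integral {a..b} \<eta> = 0"
    using \<open>integral {a..b} \<rho> \<noteq> 0\<close> by (simp add: c_def)
  obtain P where P: "\<And>x. (P has_real_derivative \<eta> x) (at x)"
    using continuous_has_antiderivative[OF cont_\<eta>] by blast
  have "(\<eta> has_integral P b - P a) {a..b}"
    using \<open>a < b\<close> P
    by (intro fundamental_theorem_of_calculus)
       (auto simp: has_real_derivative_iff_has_vector_derivative[symmetric] intro: has_field_derivative_at_within)
  \<comment> \<open>The choice of \<open>c\<close> pays off here: mean zero makes the antiderivative
    return to its starting value, so \<open>P - P a\<close> vanishes outside \<open>[a, b]\<close>
    and is an admissible test function.\<close>
  then have Pb: "P b = P a"
    using mean by (simp add: integral_unique)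
  have \<eta>_zero: "\<eta> x = 0" if "x \<notin> {a<..<b}" for x
    using \<rho>_zero[OF that] by (simp add: \<eta>_def)
  have cont_P: "continuous_on X P" for X
    by (rule DERIV_continuous_on) (rule has_field_derivative_at_within[OF P])
  have P_zero: "DERIV P y :> 0" if "y \<notin> {a<..<b}" for y
    using P[of y] \<eta>_zero[OF that] by simp
  have P_left: "P x = P a" if "x < a" for x
    using DERIV_isconst_end[OF that cont_P P_zero] by simp
  have P_right: "P x = P a" if "b < x" for x
    using DERIV_isconst_end[OF that cont_P P_zero] Pb by simp
  have D\<eta>: "integral {a..b} (\<lambda>x. D x * \<eta> x) = 0"
  proof (rule test)
    show "((\<lambda>x. P x - P a) has_real_derivative \<eta> x) (at x)" for x
      using P[of x] by (auto intro!: derivative_eq_intros)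
    show "P x - P a = 0" if "x \<notin> {a..b}" for x
      using that P_left[of x] P_right[of x] by auto
  qed (use cont_\<eta> \<eta>_zero in auto)
  \<comment> \<open>Since \<open>\<eta>\<close> has mean zero, \<open>D\<close> may be replaced by
    \<open>D - c\<close> in the tested identity, which turns the integrand into the nonnegative
    \<open>(D - c)^2 * \<rho>\<close>.\<close>
  have "integral {a..b} (\<lambda>x. (D x - c) * \<eta> x) = integral {a..b} (\<lambda>x. D x * \<eta> x) - integral {a..b} (\<lambda>x. c * \<eta> x)"
    unfolding left_diff_distrib
    by (intro integral_diff integrable_continuous_real continuous_intros cont_D cont_\<eta>)
  then have "integral {a..b} (\<lambda>x. (D x - c)\<^sup>2 * \<rho> x) = 0"
    using D\<eta> mean by (simp add: \<eta>_def power2_eq_square mult.assoc)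
  moreover have "continuous_on {a..b} (\<lambda>x. (D x - c)\<^sup>2 * \<rho> x)"
    by (intro continuous_intros cont_D cont_\<rho>)
  ultimately have "\<forall>x\<in>{a..b}. (D x - c)\<^sup>2 * \<rho> x = 0"
    using integral_eq_0_iff[of a b "\<lambda>x. (D x - c)\<^sup>2 * \<rho> x"] \<open>a < b\<close> \<rho>_nonneg by simp
  then show ?thesis
    using \<rho>_pos by (intro exI[of _ c]) force
qed

text \<open>Subtracting a classical antiderivative \<open>G\<close> of \<open>g\<close> leaves a
  continuous function with weak derivative zero. It is constant on compact intervals inside the open
  half line, hence on the closed half line, so \<open>f\<close> inherits the derivative of
  \<open>G\<close>.\<close>

lemma weak_derivative_continuous_imp_derivative:
  assumes f: "continuous_on {..0} f" and g: "continuous_on {..0} g"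
    and weak: "weak_derivative f g" and "\<xi> \<le> 0"
  shows "(f has_real_derivative g \<xi>) (at \<xi> within {..0})"
proof -
  obtain G where G: "\<And>x. (G has_real_derivative g (min x 0)) (at x)"
    using continuous_has_antiderivative[OF continuous_on_atMost_extend[OF g]] by blast
  have cont_G: "continuous_on X G" for X
    by (rule DERIV_continuous_on) (rule has_field_derivative_at_within[OF G])
  define D where "D = (\<lambda>x. f (min x 0) - G x)"
  have D: "continuous_on UNIV D"
    unfolding D_def by (intro continuous_intros continuous_on_atMost_extend f cont_G)
  have loc: "\<exists>c. \<forall>x\<in>{a<..<b}. D x = c" if "a < b" "b < 0" for a b
  proof (rule du_Bois_Reymond_continuous[OF D \<open>a < b\<close>])
    fix \<phi> \<phi>' :: "real \<Rightarrow> real"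
    assume \<phi>: "\<And>x. (\<phi> has_real_derivative \<phi>' x) (at x)" and cont: "continuous_on UNIV \<phi>'"
      and supp: "\<And>x. x \<notin> {a..b} \<Longrightarrow> \<phi> x = 0" and supp': "\<And>x. x \<notin> {a..b} \<Longrightarrow> \<phi>' x = 0"
    have cont': "continuous_on {a..b} \<phi>'" "continuous_on {a..b} f" "continuous_on {a..b} g"
      "continuous_on {a..b} \<phi>"
      using cont f g \<open>b < 0\<close> DERIV_continuous_on[of "{a..b}" \<phi> \<phi>', OF has_field_derivative_at_within[OF \<phi>]]
      by (auto elim: continuous_on_subset)
    have "(LINT \<xi>:{..0}|lborel. f \<xi> * \<phi>' \<xi>) = - (LINT \<xi>:{..0}|lborel. g \<xi> * \<phi> \<xi>)"
      using weak \<phi> cont supp \<open>b < 0\<close> unfolding weak_derivative_def by blast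
    moreover have "(LINT \<xi>:{..0}|lborel. f \<xi> * \<phi>' \<xi>) = integral {a..b} (\<lambda>\<xi>. f \<xi> * \<phi>' \<xi>)"
      by (rule set_lebesgue_integral_compact_support)
         (use supp' \<open>b < 0\<close> in \<open>auto intro!: continuous_intros cont'\<close>)
    moreover have "(LINT \<xi>:{..0}|lborel. g \<xi> * \<phi> \<xi>) = integral {a..b} (\<lambda>\<xi>. g \<xi> * \<phi> \<xi>)"
      by (rule set_lebesgue_integral_compact_support)
         (use supp \<open>b < 0\<close> in \<open>auto intro!: continuous_intros cont'\<close>)
    ultimately have weak': "integral {a..b} (\<lambda>\<xi>. f \<xi> * \<phi>' \<xi>) = - integral {a..b} (\<lambda>\<xi>. g \<xi> * \<phi> \<xi>)"
      by simp
    \<comment> \<open>The support condition says nothing at the end points themselves; the boundary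
      terms vanish there by continuity from outside the interval.\<close>
    have \<phi>_end: "\<phi> a = 0" "\<phi> b = 0"
    proof -
      have "isCont \<phi> x" for x using \<phi> by (rule DERIV_isCont)
      then have left: "(\<phi> \<longlongrightarrow> \<phi> a) (at_left a)" and right: "(\<phi> \<longlongrightarrow> \<phi> b) (at_right b)"
        by (auto simp: isCont_def intro: tendsto_within_subset)
      have "\<forall>\<^sub>F x in at_left a. \<phi> x = 0"
        by (rule eventually_at_leftI[of "a - 1"]) (auto intro: supp)
      then show "\<phi> a = 0"
        by (intro tendsto_unique[OF trivial_limit_at_left_real left] tendsto_eventually)
      have "\<forall>\<^sub>F x in at_right b. \<phi> x = 0"
        by (rule eventually_at_rightI[of b "b + 1"]) (auto intro: supp)
      then show "\<phi> b = 0"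
        by (intro tendsto_unique[OF trivial_limit_at_right_real right] tendsto_eventually)
    qed
    \<comment> \<open>Integration by parts for \<open>G * \<phi>\<close>: \<open>G\<close> satisfies
      the same tested identity as \<open>f\<close>, so the two cancel in \<open>D\<close>.\<close>
    have "((\<lambda>x. g x * \<phi> x + G x * \<phi>' x) has_integral (G b * \<phi> b - G a * \<phi> a)) {a..b}"
    proof (rule fundamental_theorem_of_calculus)
      fix x assume x: "x \<in> {a..b}"
      then have "min x 0 = x" using \<open>b < 0\<close> by simp
      then have "((\<lambda>x. G x * \<phi> x) has_real_derivative (g x * \<phi> x + G x * \<phi>' x)) (at x)"
        using DERIV_mult[OF G[of x] \<phi>[of x]] by (simp add: algebra_simps)
      then show "((\<lambda>x. G x * \<phi> x) has_vector_derivative (g x * \<phi> x + G x * \<phi>' x)) (at x within {a..b})"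
        by (simp add: has_real_derivative_iff_has_vector_derivative[symmetric] has_field_derivative_at_within)
    qed (use \<open>a < b\<close> in simp)
    then have "integral {a..b} (\<lambda>x. g x * \<phi> x + G x * \<phi>' x) = 0"
      by (simp add: \<phi>_end integral_unique)
    moreover have "integral {a..b} (\<lambda>x. g x * \<phi> x + G x * \<phi>' x)
        = integral {a..b} (\<lambda>x. g x * \<phi> x) + integral {a..b} (\<lambda>x. G x * \<phi>' x)"
      by (intro integral_add integrable_continuous_real continuous_intros cont' cont_G)
    moreover have "integral {a..b} (\<lambda>x. D x * \<phi>' x) = integral {a..b} (\<lambda>x. f x * \<phi>' x - G x * \<phi>' x)"
      by (rule Henstock_Kurzweil_Integration.integral_cong)
         (use \<open>b < 0\<close> in \<open>auto simp: D_def min_def algebra_simps\<close>)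
    moreover have "integral {a..b} (\<lambda>x. f x * \<phi>' x - G x * \<phi>' x)
        = integral {a..b} (\<lambda>x. f x * \<phi>' x) - integral {a..b} (\<lambda>x. G x * \<phi>' x)"
      by (intro integral_diff integrable_continuous_real continuous_intros cont' cont_G)
    ultimately show "integral {a..b} (\<lambda>x. D x * \<phi>' x) = 0"
      using weak' by simp
  qed
  \<comment> \<open>The local constants are matched through one interval that contains both
    \<open>x\<close> and \<open>-1\<close>; half the larger of the two is still negative, so the
    interval stays inside the open half line.\<close>
  have D_neg: "D x = D (-1)" if "x < 0" for x
  proof -
    have "min x (-1) - 1 < max x (-1) / 2" "max x (-1) / 2 < 0"
      using that by linarith+
    then obtain c where c: "\<forall>y\<in>{min x (-1) - 1<..<max x (-1) / 2}. D y = c"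
      using loc by blast
    have "x \<in> {min x (-1) - 1<..<max x (-1) / 2}" "-1 \<in> {min x (-1) - 1<..<max x (-1) / 2}"
      using that by (simp_all, linarith+)
    then show ?thesis using c by metis
  qed
  \<comment> \<open>Test functions do not see the end point 0; the constant is carried there by the
    left limit.\<close>
  have D_nonpos: "D x = D (-1)" if "x \<le> 0" for x
  proof (cases "x = 0")
    case True
    have "isCont D 0"
      using D by (simp add: continuous_on_eq_continuous_at)
    then have D0: "(D \<longlongrightarrow> D 0) (at_left 0)"
      by (auto simp: isCont_def intro: tendsto_within_subset)
    have "\<forall>\<^sub>F x in at_left 0. D x = D (-1)"
      by (rule eventually_at_leftI[of "-1"]) (auto intro: D_neg)
    then have "D 0 = D (-1)"
      by (intro tendsto_unique[OF trivial_limit_at_left_real D0] tendsto_eventually)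
    then show ?thesis using True by simp
  next
    case False
    then show ?thesis using D_neg[of x] that by simp
  qed
  have f_eq: "f x = G x + D (-1)" if "x \<in> {..0}" for x
  proof -
    have "min x 0 = x" using that by simp
    then have "D x = f x - G x" by (simp add: D_def)
    then show ?thesis using D_nonpos[of x] that by simp
  qed
  have "((\<lambda>x. G x + D (-1)) has_real_derivative g \<xi>) (at \<xi> within {..0})"
    using DERIV_add[OF has_field_derivative_at_within[OF G[of \<xi>]] DERIV_const] \<open>\<xi> \<le> 0\<close>
    by (simp add: min_absorb1)
  then show ?thesis
    by (rule has_field_derivative_transform_within[OF _ zero_less_one]) (use f_eq \<open>\<xi> \<le> 0\<close> in auto)
qed

lemma locally_abs_cont_imp_continuous_on:
  assumes "locally_abs_cont f"
  shows "continuous_on {..0} f"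
  unfolding continuous_on_iff
proof (intro ballI allI impI)
  fix x \<epsilon> :: real assume x: "x \<in> {..0}" and \<epsilon>: "\<epsilon> > 0"
  \<comment> \<open>The compact window \<open>[x - 1, 0]\<close> contains every point of the half
    line within distance 1 of \<open>x\<close>, hence the radius \<open>min \<delta> 1\<close>
    below; the families of intervals used are singletons.\<close>
  have "x - 1 \<le> 0" using x by simp
  from assms[unfolded locally_abs_cont_def, THEN spec, THEN mp, OF this, THEN spec, THEN mp, OF \<epsilon>]
  obtain \<delta> where "\<delta> > 0" and \<delta>: "\<forall>D. finite D \<and>
        (\<forall>(u, v)\<in>D. x - 1 \<le> u \<and> u < v \<and> v \<le> 0) \<and>
        pairwise (\<lambda>(x, y) (x', y'). {x<..<y} \<inter> {x'<..<y'} = {}) D \<and>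
        (\<Sum>(x, y)\<in>D. y - x) < \<delta> \<longrightarrow> (\<Sum>(x, y)\<in>D. \<bar>f y - f x\<bar>) < \<epsilon>"
    by (elim exE conjE)
  have step: "\<bar>f v - f u\<bar> < \<epsilon>" if "x - 1 \<le> u" "u < v" "v \<le> 0" "v - u < \<delta>" for u v
    using \<delta>[THEN spec, of "{(u, v)}"] that by (simp add: pairwise_def)
  have "dist (f y) (f x) < \<epsilon>" if y: "y \<in> {..0}" "dist y x < min \<delta> 1" for y
  proof (cases x y rule: linorder_cases)
    case less then show ?thesis using step[of x y] x y by (auto simp: dist_real_def)
  next
    case greater then show ?thesis using step[of y x] x y by (auto simp: dist_real_def)
  qed (use \<epsilon> in simp)
  then show "\<exists>d>0. \<forall>x'\<in>{..0}. dist x' x < d \<longrightarrow> dist (f x') (f x) < \<epsilon>"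
    using \<open>\<delta> > 0\<close> by (intro exI[of _ "min \<delta> 1"]) auto
qed


section \<open>The weighted space and shifted paths\<close>

lemma weight_pos: "weight w \<Longrightarrow> \<xi> \<le> 0 \<Longrightarrow> 0 < w \<xi>"
  by (simp add: weight_def)

lemma weight_has_derivative:
  assumes "weight w" "\<xi> \<le> 0"
  shows "(w has_real_derivative wder w \<xi>) (at \<xi> within {..0})"
proof -
  have "w differentiable (at \<xi> within {..0})"
    using assms by (auto simp: weight_def differentiable_on_def)
  then show ?thesis
    by (simp add: wder_def has_real_derivative_iff_has_vector_derivative vector_derivative_works)
qed

lemma continuous_on_weight: "weight w \<Longrightarrow> continuous_on {..0} w"
  by (simp add: weight_def differentiable_imp_continuous_on)

text \<open>Nothing is assumed about \<open>w\<close> at positive arguments, so measurability is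
  stated after clamping at 0; the clamp disappears under the indicator of the half line.\<close>

lemma weight_measurable [measurable]:
  assumes "weight w"
  shows "(\<lambda>\<xi>. w (min \<xi> 0)) \<in> borel_measurable borel"
  by (intro borel_measurable_continuous_onI continuous_on_compose2[OF continuous_on_weight[OF assms]])
     (auto intro!: continuous_intros)

text \<open>The bound \<open>w'/w >= -K\<close> makes \<open>exp (K * \<xi>) * w \<xi>\<close>
  nondecreasing. This is the form in which boundedness of \<open>w'/w\<close> controls time shifts
  of the past.\<close>

lemma weight_growth:
  assumes "weight w"
  obtains K where "K \<ge> 0" "\<And>\<xi> \<eta>. \<xi> \<le> \<eta> \<Longrightarrow> \<eta> \<le> 0 \<Longrightarrow> w \<xi> \<le> exp (K * (\<eta> - \<xi>)) * w \<eta>"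
proof -
  obtain K0 where K0: "\<And>\<xi>. \<xi> \<le> 0 \<Longrightarrow> \<bar>wder w \<xi> / w \<xi>\<bar> \<le> K0"
    using assms unfolding weight_def bounded_iff by auto
  define K where "K = max K0 0"
  have "w \<xi> \<le> exp (K * (\<eta> - \<xi>)) * w \<eta>" if "\<xi> \<le> \<eta>" "\<eta> \<le> 0" for \<xi> \<eta>
  proof -
    have "exp (K * \<xi>) * w \<xi> \<le> exp (K * \<eta>) * w \<eta>"
    proof (rule DERIV_nonneg_imp_increasing_open[OF \<open>\<xi> \<le> \<eta>\<close>])
      fix x assume x: "\<xi> < x" "x < \<eta>"
      then have "x < 0" using that by simp
      then have "(w has_real_derivative wder w x) (at x)"
        using weight_has_derivative[OF assms, of x] at_within_open_subset[of x "{..<0}" "{..0}"]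
        by (simp add: subset_eq)
      then have "DERIV (\<lambda>x. exp (K * x) * w x) x :> exp (K * x) * (K * w x + wder w x)"
        by (auto intro!: derivative_eq_intros simp: algebra_simps)
      moreover have "K * w x + wder w x \<ge> 0"
      proof -
        have "\<bar>wder w x / w x\<bar> \<le> K0"
          using \<open>x < 0\<close> by (intro K0) simp
        then have "- K \<le> wder w x / w x"
          unfolding K_def by linarith
        then show ?thesis
          using weight_pos[OF assms, of x] \<open>x < 0\<close> by (simp add: le_divide_eq)
      qed
      ultimately show "\<exists>y. DERIV (\<lambda>x. exp (K * x) * w x) x :> y \<and> y \<ge> 0"
        using mult_nonneg_nonneg[OF exp_ge_zero] by blast
    next
      have "continuous_on {\<xi>..\<eta>} w"
        using continuous_on_weight[OF assms] by (rule continuous_on_subset) (use that in auto)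
      then show "continuous_on {\<xi>..\<eta>} (\<lambda>x. exp (K * x) * w x)"
        by (intro continuous_intros)
    qed
    then have "exp (- (K * \<xi>)) * (exp (K * \<xi>) * w \<xi>) \<le> exp (- (K * \<xi>)) * (exp (K * \<eta>) * w \<eta>)"
      by (rule mult_left_mono) simp
    then show ?thesis
      by (simp add: mult.assoc[symmetric] exp_add[symmetric] right_diff_distrib)
  qed
  then show ?thesis
    using that[of K] by (simp add: K_def)
qed

lemma L2w_measurable:
  "f \<in> L2w w \<Longrightarrow> (\<lambda>\<xi>. indicator {..0} \<xi> * f \<xi>) \<in> borel_measurable borel"
  by (simp add: L2w_def set_borel_measurable_def)

lemma L2w_mult_measurable:
  assumes "weight w" "f \<in> L2w w" "g \<in> L2w w"
  shows "(\<lambda>\<xi>. indicator {..0} \<xi> * (f \<xi> * g \<xi> * w \<xi>)) \<in> borel_measurable borel"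
proof -
  note [measurable] = L2w_measurable[OF assms(2)] L2w_measurable[OF assms(3)] weight_measurable[OF assms(1)]
  have "(\<lambda>\<xi>. (indicator {..0} \<xi> * f \<xi>) * (indicator {..0} \<xi> * g \<xi>) * w (min \<xi> 0)) \<in> borel_measurable borel"
    by measurable
  also have "(\<lambda>\<xi>. (indicator {..0} \<xi> * f \<xi>) * (indicator {..0} \<xi> * g \<xi>) * w (min \<xi> 0))
      = (\<lambda>\<xi>. indicator {..0} \<xi> * (f \<xi> * g \<xi> * w \<xi>))"
    by (auto simp: indicator_def fun_eq_iff min_def)
  finally show ?thesis .
qed

lemma weighted_product_le:
  fixes a b v :: real
  assumes "0 \<le> v"
  shows "\<bar>a * b * v\<bar> \<le> a\<^sup>2 * v + b\<^sup>2 * v"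
proof -
  have "2 * \<bar>a * b\<bar> \<le> a\<^sup>2 + b\<^sup>2"
    using sum_squares_bound[of "\<bar>a\<bar>" "\<bar>b\<bar>"] by (simp add: abs_mult mult.assoc)
  then have "\<bar>a * b\<bar> \<le> a\<^sup>2 + b\<^sup>2"
    by linarith
  then have "\<bar>a * b\<bar> * v \<le> (a\<^sup>2 + b\<^sup>2) * v"
    using assms by (rule mult_right_mono)
  then show ?thesis
    using assms by (simp add: abs_mult algebra_simps)
qed

text \<open>The inequality \<open>|a * b| <= a^2 + b^2\<close> serves in place of Cauchy-Schwarz.
  The quantitative part later bounds pairings with shifted paths uniformly in the shift.\<close>

lemma set_integrable_L2w_mult:
  assumes w: "weight w" and f: "f \<in> L2w w" and g: "g \<in> L2w w"
  shows "set_integrable lborel {..0} (\<lambda>\<xi>. f \<xi> * g \<xi> * w \<xi>)"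
    and "(LINT \<xi>:{..0}|lborel. \<bar>f \<xi> * g \<xi> * w \<xi>\<bar>)
      \<le> (LINT \<xi>:{..0}|lborel. (f \<xi>)\<^sup>2 * w \<xi>) + (LINT \<xi>:{..0}|lborel. (g \<xi>)\<^sup>2 * w \<xi>)"
proof -
  have int: "set_integrable lborel {..0} (\<lambda>\<xi>. (f \<xi>)\<^sup>2 * w \<xi>)" "set_integrable lborel {..0} (\<lambda>\<xi>. (g \<xi>)\<^sup>2 * w \<xi>)"
    using f g by (auto simp: L2w_def)
  have sum_int: "set_integrable lborel {..0} (\<lambda>\<xi>. (f \<xi>)\<^sup>2 * w \<xi> + (g \<xi>)\<^sup>2 * w \<xi>)"
    using int by (rule set_integral_add)
  have le: "\<bar>f \<xi> * g \<xi> * w \<xi>\<bar> \<le> (f \<xi>)\<^sup>2 * w \<xi> + (g \<xi>)\<^sup>2 * w \<xi>" if "\<xi> \<le> 0" for \<xi>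
    using weight_pos[OF w that] by (intro weighted_product_le) simp
  show int': "set_integrable lborel {..0} (\<lambda>\<xi>. f \<xi> * g \<xi> * w \<xi>)"
    unfolding set_integrable_def
  proof (rule Bochner_Integration.integrable_bound[OF sum_int[unfolded set_integrable_def]])
    show "AE \<xi> in lborel. norm (indicator {..0} \<xi> *\<^sub>R (f \<xi> * g \<xi> * w \<xi>))
        \<le> norm (indicator {..0} \<xi> *\<^sub>R ((f \<xi>)\<^sup>2 * w \<xi> + (g \<xi>)\<^sup>2 * w \<xi>))"
      by (intro AE_I2) (auto simp: indicator_def intro: order_trans[OF le])
  qed (use L2w_mult_measurable[OF w f g] in simp)
  have "(LINT \<xi>:{..0}|lborel. \<bar>f \<xi> * g \<xi> * w \<xi>\<bar>)
      \<le> (LINT \<xi>:{..0}|lborel. (f \<xi>)\<^sup>2 * w \<xi> + (g \<xi>)\<^sup>2 * w \<xi>)"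
    using int' sum_int le by (intro set_integral_mono set_integrable_abs) auto
  then show "(LINT \<xi>:{..0}|lborel. \<bar>f \<xi> * g \<xi> * w \<xi>\<bar>)
      \<le> (LINT \<xi>:{..0}|lborel. (f \<xi>)\<^sup>2 * w \<xi>) + (LINT \<xi>:{..0}|lborel. (g \<xi>)\<^sup>2 * w \<xi>)"
    using set_integral_add(2)[OF int] by simp
qed

lemma L2w_inner_cong:
  assumes w: "weight w" and "f \<in> L2w w" "f' \<in> L2w w" "g \<in> L2w w" "g' \<in> L2w w"
    and "ae_eq f f'" "ae_eq g g'"
  shows "L2w_inner w f g = L2w_inner w f' g'"
  unfolding L2w_inner_def set_lebesgue_integral_def
proof (rule integral_cong_AE)
  show "AE \<xi> in lborel. indicator {..0} \<xi> *\<^sub>R (f \<xi> * g \<xi> * w \<xi>) = indicator {..0} \<xi> *\<^sub>R (f' \<xi> * g' \<xi> * w \<xi>)"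
    using assms(6,7) unfolding ae_eq_def by eventually_elim (auto simp: indicator_def)
qed (use L2w_mult_measurable[OF w] assms in simp_all)

lemma delay_path_measurable:
  fixes x :: "real \<Rightarrow> real"
  assumes "s1 \<in> L2w w" "\<And>v. v < 0 \<Longrightarrow> x v = s1 v" "continuous_on {0..} x"
  shows "x \<in> borel_measurable borel"
proof -
  note [measurable] = L2w_measurable[OF assms(1)]
  have "continuous_on UNIV (\<lambda>v. x (max 0 v))"
    by (rule continuous_on_compose2[OF assms(3)]) (auto intro!: continuous_intros)
  note [measurable] = borel_measurable_continuous_onI[OF this]
  have "(\<lambda>v. if v < 0 then indicator {..0} v * s1 v else x (max 0 v)) \<in> borel_measurable borel"
    by measurable
  also have "(\<lambda>v. if v < 0 then indicator {..0} v * s1 v else x (max 0 v)) = x"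
    by (auto simp: fun_eq_iff assms(2) max_def)
  finally show ?thesis .
qed

text \<open>A single integrable \<open>G\<close>, read at \<open>t + \<xi>\<close>, dominates the
  weighted square for every \<open>t\<close> in \<open>[0, T]\<close>. Translation invariance of
  Lebesgue measure then makes the integral of \<open>G\<close> a bound that does not depend on
  \<open>t\<close>.\<close>

lemma delay_path_shift_L2w:
  fixes x :: "real \<Rightarrow> real"
  assumes w: "weight w" and s1: "s1 \<in> L2w w" "\<And>v. v < 0 \<Longrightarrow> x v = s1 v"
    and x: "continuous_on {0..} x"
  obtains N where "\<And>t. 0 \<le> t \<Longrightarrow> t \<le> T \<Longrightarrow> (\<lambda>\<xi>. x (t + \<xi>)) \<in> L2w w"
    and "\<And>t. 0 \<le> t \<Longrightarrow> t \<le> T \<Longrightarrow> (LINT \<xi>:{..0}|lborel. (x (t + \<xi>))\<^sup>2 * w \<xi>) \<le> N"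
proof -
  note [measurable] = delay_path_measurable[OF s1 x] weight_measurable[OF w]
  obtain K where "K \<ge> 0" and K: "\<And>\<xi> \<eta>. \<xi> \<le> \<eta> \<Longrightarrow> \<eta> \<le> 0 \<Longrightarrow> w \<xi> \<le> exp (K * (\<eta> - \<xi>)) * w \<eta>"
    using weight_growth[OF w] by blast
  \<comment> \<open>The factor \<open>exp (K * T)\<close> covers both regimes: on the past it
    compares \<open>w \<xi>\<close> with \<open>w (t + \<xi>)\<close>, and on \<open>[0, T]\<close>
    it compares \<open>w \<xi>\<close> with \<open>w 0 = 1\<close>, where
    \<open>- \<xi> \<le> t \<le> T\<close>.\<close>
  define G where "G = (\<lambda>v. exp (K * T) *
      (indicator {..<0} v * ((s1 v)\<^sup>2 * w v) + indicator {0..T} v * (x v)\<^sup>2))"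
  have "set_integrable lborel {..<0} (\<lambda>v. (s1 v)\<^sup>2 * w v)"
    by (rule set_integrable_subset[of _ "{..0}"]) (use s1 in \<open>auto simp: L2w_def\<close>)
  moreover have "set_integrable lborel {0..T} (\<lambda>v. (x v)\<^sup>2)"
    by (intro borel_integrable_atLeastAtMost' continuous_intros continuous_on_subset[OF x]) auto
  ultimately have G: "integrable lborel G"
    unfolding G_def set_integrable_def
    by (intro integrable_mult_right Bochner_Integration.integrable_add) simp_all
  have dom: "\<bar>indicator {..0} \<xi> * ((x (t + \<xi>))\<^sup>2 * w \<xi>)\<bar> \<le> G (t + \<xi>)" if t: "0 \<le> t" "t \<le> T" for t \<xi>
  proof (cases "\<xi> \<le> 0")
    case False
    have "w v > 0" if "v < 0" for v using weight_pos[OF w] that by simp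
    with False show ?thesis by (auto simp: G_def indicator_def less_imp_le)
  next
    case True
    have "w \<xi> > 0" using weight_pos[OF w True] .
    show ?thesis
    proof (cases "t + \<xi> < 0")
      case neg: True
      have "w \<xi> \<le> exp (K * t) * w (t + \<xi>)"
        using K[of \<xi> "t + \<xi>"] neg t by simp
      also have "\<dots> \<le> exp (K * T) * w (t + \<xi>)"
        using t \<open>K \<ge> 0\<close> weight_pos[OF w, of "t + \<xi>"] neg by (intro mult_right_mono) (auto intro: mult_left_mono)
      finally have "(s1 (t + \<xi>))\<^sup>2 * w \<xi> \<le> (s1 (t + \<xi>))\<^sup>2 * (exp (K * T) * w (t + \<xi>))"
        by (rule mult_left_mono) simp
      then show ?thesis
        using neg True \<open>w \<xi> > 0\<close> s1(2)[OF neg] by (simp add: G_def mult_ac)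
    next
      case nonneg: False
      have "w \<xi> \<le> exp (K * (- \<xi>)) * w 0"
        using K[of \<xi> 0] True by simp
      also have "w 0 = 1" using w by (simp add: weight_def)
      also have "exp (K * (- \<xi>)) * 1 \<le> exp (K * T)"
        using mult_left_mono[of "- \<xi>" T K] nonneg t \<open>K \<ge> 0\<close> by simp
      finally have "(x (t + \<xi>))\<^sup>2 * w \<xi> \<le> (x (t + \<xi>))\<^sup>2 * exp (K * T)"
        by (rule mult_left_mono) simp
      then show ?thesis
        using nonneg True t \<open>w \<xi> > 0\<close> by (simp add: G_def mult_ac)
    qed
  qed
  have G_shift: "integrable lborel (\<lambda>\<xi>. G (t + \<xi>))" "(\<integral>\<xi>. G (t + \<xi>) \<partial>lborel) = (\<integral>\<xi>. G \<xi> \<partial>lborel)" for t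
    using lborel_integrable_real_affine[OF G, of 1 t] lborel_integral_real_affine[of 1 G t] by simp_all
  have int: "set_integrable lborel {..0} (\<lambda>\<xi>. (x (t + \<xi>))\<^sup>2 * w \<xi>)" if t: "0 \<le> t" "t \<le> T" for t
    unfolding set_integrable_def
  proof (rule Bochner_Integration.integrable_bound[OF G_shift(1)[of t]])
    have "(\<lambda>\<xi>. indicator {..0} \<xi> * ((x (t + \<xi>))\<^sup>2 * w (min \<xi> 0))) \<in> borel_measurable lborel"
      by measurable
    also have "(\<lambda>\<xi>. indicator {..0} \<xi> * ((x (t + \<xi>))\<^sup>2 * w (min \<xi> 0)))
        = (\<lambda>\<xi>. indicator {..0} \<xi> *\<^sub>R ((x (t + \<xi>))\<^sup>2 * w \<xi>))"
      by (auto simp: fun_eq_iff indicator_def min_def)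
    finally show "(\<lambda>\<xi>. indicator {..0} \<xi> *\<^sub>R ((x (t + \<xi>))\<^sup>2 * w \<xi>)) \<in> borel_measurable lborel" .
    show "AE \<xi> in lborel. norm (indicator {..0} \<xi> *\<^sub>R ((x (t + \<xi>))\<^sup>2 * w \<xi>)) \<le> norm (G (t + \<xi>))"
      by (intro AE_I2) (use dom[OF t] in \<open>auto intro: order_trans[OF _ abs_ge_self]\<close>)
  qed
  show ?thesis
  proof (rule that)
    fix t assume t: "0 \<le> t" "t \<le> T"
    have "set_borel_measurable lborel {..0} (\<lambda>\<xi>. x (t + \<xi>))"
      unfolding set_borel_measurable_def by measurable
    then show "(\<lambda>\<xi>. x (t + \<xi>)) \<in> L2w w"
      using int[OF t] by (simp add: L2w_def)
    have "(LINT \<xi>:{..0}|lborel. (x (t + \<xi>))\<^sup>2 * w \<xi>) \<le> (\<integral>\<xi>. G (t + \<xi>) \<partial>lborel)"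
      unfolding set_lebesgue_integral_def
      by (rule integral_mono[OF int[OF t, unfolded set_integrable_def] G_shift(1)])
         (use dom[OF t] in \<open>auto intro: order_trans[OF abs_ge_self]\<close>)
    then show "(LINT \<xi>:{..0}|lborel. (x (t + \<xi>))\<^sup>2 * w \<xi>) \<le> (\<integral>\<xi>. G \<xi> \<partial>lborel)"
      by (simp add: G_shift)
  qed
qed


text \<open>The inner integral of the Fubini argument. For \<open>v \<le> a \<le> r\<close> the
  argument \<open>v - r\<close> stays in the half line, so \<open>- \<phi> (v - r)\<close> is an
  antiderivative in \<open>r\<close>; the \<open>min\<close> makes the integrand meaningful for all
  \<open>r\<close>.\<close>

lemma integral_reflected_derivative:
  fixes \<phi> \<psi> :: "real \<Rightarrow> real"
  assumes \<phi>: "\<And>\<xi>. \<xi> \<le> 0 \<Longrightarrow> (\<phi> has_real_derivative \<psi> \<xi>) (at \<xi> within {..0})"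
    and \<psi>: "continuous_on {..0} \<psi>" and "v \<le> a" "a \<le> c"
  shows "(\<integral>r. indicator {a..c} r * \<psi> (min (v - r) 0) \<partial>lborel) = \<phi> (v - a) - \<phi> (v - c)"
proof -
  have "(\<integral>r. indicator {a..c} r *\<^sub>R \<psi> (min (v - r) 0) \<partial>lborel) = - \<phi> (v - c) - (- \<phi> (v - a))"
  proof (rule integral_FTC_atLeastAtMost[OF \<open>a \<le> c\<close>])
    fix r assume r: "a \<le> r" "r \<le> c"
    have h1: "(\<phi> has_real_derivative \<psi> (v - r)) (at (v - r) within (\<lambda>r. v - r) ` {a..c})"
      by (rule DERIV_subset[OF \<phi>]) (use r \<open>v \<le> a\<close> in auto)
    have h2: "((\<lambda>r. v - r) has_real_derivative -1) (at r within {a..c})"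
      by (auto intro!: derivative_eq_intros)
    have "((\<lambda>r. \<phi> (v - r)) has_real_derivative \<psi> (v - r) * -1) (at r within {a..c})"
      using DERIV_image_chain[where g = "\<lambda>r. v - r", OF h1 h2] by (simp only: o_def)
    then have "((\<lambda>r. - \<phi> (v - r)) has_real_derivative \<psi> (v - r)) (at r within {a..c})"
      using DERIV_minus by fastforce
    then show "((\<lambda>r. - \<phi> (v - r)) has_vector_derivative \<psi> (min (v - r) 0)) (at r within {a..c})"
      using r \<open>v \<le> a\<close> by (simp add: has_real_derivative_iff_has_vector_derivative min_absorb1)
  next
    show "continuous_on {a..c} (\<lambda>r. \<psi> (min (v - r) 0))"
      by (rule continuous_on_compose2[OF \<psi>]) (auto intro!: continuous_intros)
  qed
  then show ?thesis by simp
qed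

text \<open>Fubini for \<open>\<psi> (v - r) * x v\<close> over \<open>0 \<le> r \<le> t\<close>, \<open>v \<le> r\<close>: integrating in \<open>r\<close> first gives
  \<open>x v * (\<phi> (min v 0) - \<phi> (v - t))\<close>. Thus no regularity of the path is needed to differentiate the
  pairing in time.\<close>

lemma delay_pairing_integral:
  fixes \<phi> \<psi> x :: "real \<Rightarrow> real"
  assumes \<phi>: "\<And>\<xi>. \<xi> \<le> 0 \<Longrightarrow> (\<phi> has_real_derivative \<psi> \<xi>) (at \<xi> within {..0})"
    and \<psi>: "continuous_on {..0} \<psi>"
    and x [measurable]: "x \<in> borel_measurable borel" and cont_x: "continuous_on {0..} x"
    and "t \<ge> 0"
    and int_\<phi>: "\<And>r. r \<ge> 0 \<Longrightarrow> set_integrable lborel {..0} (\<lambda>\<xi>. \<phi> \<xi> * x (r + \<xi>))"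
    and int_\<psi>: "\<And>r. 0 \<le> r \<Longrightarrow> r \<le> t \<Longrightarrow> set_integrable lborel {..0} (\<lambda>\<xi>. \<psi> \<xi> * x (r + \<xi>))"
    and bound: "\<And>r. 0 \<le> r \<Longrightarrow> r \<le> t \<Longrightarrow> (LINT \<xi>:{..0}|lborel. \<bar>\<psi> \<xi> * x (r + \<xi>)\<bar>) \<le> N"
  shows "set_integrable lborel {0..t} (\<lambda>r. LINT \<xi>:{..0}|lborel. \<psi> \<xi> * x (r + \<xi>))" (is ?int)
    and "(LINT \<xi>:{..0}|lborel. \<phi> \<xi> * x (t + \<xi>)) = (LINT \<xi>:{..0}|lborel. \<phi> \<xi> * x \<xi>)
      + \<phi> 0 * (LINT r:{0..t}|lborel. x r) - (LINT r:{0..t}|lborel. LINT \<xi>:{..0}|lborel. \<psi> \<xi> * x (r + \<xi>))"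
      (is ?eq)
proof -
  have "continuous_on UNIV (\<lambda>\<xi>. \<psi> (min \<xi> 0))"
    by (rule continuous_on_compose2[OF \<psi>]) (auto intro!: continuous_intros)
  note [measurable] = borel_measurable_continuous_onI[OF this]
  \<comment> \<open>Here \<open>v = r + \<xi>\<close> is absolute time: in these coordinates the
    path factor \<open>x v\<close> does not depend on \<open>r\<close> and can be pulled out of the
    \<open>r\<close>-integral.\<close>
  define F where "F = (\<lambda>r v. indicator {0..t} r * (indicator {..0} (v - r) * \<psi> (min (v - r) 0) * x v))"
  have [measurable]: "(\<lambda>p. F (fst p) (snd p)) \<in> borel_measurable (lborel \<Otimes>\<^sub>M lborel)"
    unfolding F_def by measurable
  have F_shift: "F r (r + \<xi>) = indicator {0..t} r * (indicator {..0} \<xi> * (\<psi> \<xi> * x (r + \<xi>)))" for r \<xi>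
    by (auto simp: F_def indicator_def min_def)
  have F_inner: "(\<integral>v. F r v \<partial>lborel) = indicator {0..t} r * (LINT \<xi>:{..0}|lborel. \<psi> \<xi> * x (r + \<xi>))" for r
    using lborel_integral_real_affine[of 1 "F r" r] by (simp add: F_shift set_lebesgue_integral_def)
  have F_norm: "(\<integral>v. norm (F r v) \<partial>lborel) = indicator {0..t} r * (LINT \<xi>:{..0}|lborel. \<bar>\<psi> \<xi> * x (r + \<xi>)\<bar>)" for r
    using lborel_integral_real_affine[of 1 "\<lambda>v. norm (F r v)" r]
    by (simp add: F_shift set_lebesgue_integral_def abs_mult)
  have F_int: "integrable lborel (F r)" for r
  proof (cases "r \<in> {0..t}")
    case True
    then have "integrable lborel (\<lambda>\<xi>. F r (r + 1 * \<xi>))"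
      using int_\<psi>[of r] by (simp add: F_shift set_integrable_def)
    then show ?thesis
      using lborel_integrable_real_affine_iff[of 1 "F r" r] by simp
  qed (simp add: F_def)
  \<comment> \<open>Tonelli with the uniform bound: the inner absolute integral is at most
    \<open>N\<close> for \<open>r\<close> in the bounded interval \<open>[0, t]\<close> and zero
    elsewhere.\<close>
  have F: "integrable (lborel \<Otimes>\<^sub>M lborel) (\<lambda>p. F (fst p) (snd p))"
  proof (rule lborel_pair.Fubini_integrable)
    show "integrable lborel (\<lambda>r. \<integral>v. norm (F (fst (r, v)) (snd (r, v))) \<partial>lborel)"
    proof (rule Bochner_Integration.integrable_bound)
      show "integrable lborel (\<lambda>r. indicator {0..t} r * N)"
        by (intro integrable_mult_left integrable_real_indicator) (simp_all add: emeasure_lborel_Icc_eq)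
      show "AE r in lborel. norm (\<integral>v. norm (F (fst (r, v)) (snd (r, v))) \<partial>lborel) \<le> norm (indicator {0..t} r * N)"
      proof (rule AE_I2)
        fix r
        have "0 \<le> (\<integral>v. norm (F r v) \<partial>lborel)" by simp
        then show "norm (\<integral>v. norm (F (fst (r, v)) (snd (r, v))) \<partial>lborel) \<le> norm (indicator {0..t} r * N)"
          using bound[of r] unfolding fst_conv snd_conv F_norm by (auto simp: indicator_def)
      qed
    qed measurable
  qed (use F_int in simp_all)
  then have F': "integrable (lborel \<Otimes>\<^sub>M lborel) (case_prod F)"
    by (simp add: case_prod_beta')
  show ?int
    using lborel_pair.integrable_fst[OF F'] by (simp add: F_inner set_integrable_def)
  define J where "J = (\<lambda>v. \<integral>r. F r v \<partial>lborel)"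
  have J: "integrable lborel J"
    unfolding J_def by (rule lborel_pair.integrable_snd[OF F'])
  have J_eq: "J v = indicator {..t} v * (x v * (\<phi> (min v 0) - \<phi> (v - t)))" for v
  proof (cases "v \<le> t")
    case True
    \<comment> \<open>The constraints \<open>0 \<le> r \<le> t\<close> and \<open>v \<le> r\<close>
      leave \<open>[max v 0, t]\<close>; its lower end contributes
      \<open>v - max v 0 = min v 0\<close>.\<close>
    have "F r v = x v * (indicator {max v 0..t} r * \<psi> (min (v - r) 0))" for r
      by (auto simp: F_def indicator_def)
    then have "J v = x v * (\<integral>r. indicator {max v 0..t} r * \<psi> (min (v - r) 0) \<partial>lborel)"
      by (simp add: J_def)
    also have "(\<integral>r. indicator {max v 0..t} r * \<psi> (min (v - r) 0) \<partial>lborel) = \<phi> (v - max v 0) - \<phi> (v - t)"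
      by (rule integral_reflected_derivative[OF \<phi> \<psi>]) (use True \<open>t \<ge> 0\<close> in auto)
    also have "v - max v 0 = min v 0" by auto
    finally show ?thesis using True by simp
  next
    case False
    then have "F r v = 0" for r by (auto simp: F_def indicator_def)
    with False show ?thesis by (simp add: J_def)
  qed
  \<comment> \<open>The term \<open>\<phi> (min v 0)\<close> splits into \<open>\<phi> v\<close> on
    the past, giving the pairing at time 0, and \<open>\<phi> 0\<close> on \<open>[0, t]\<close>,
    giving the boundary term; \<open>C\<close> becomes the pairing at time \<open>t\<close> after a
    shift.\<close>
  define A where "A = (\<lambda>v. indicator {..0} v * (\<phi> v * x v))"
  define B where "B = (\<lambda>v. indicator {0..t} v * (\<phi> 0 * x v))"
  define C where "C = (\<lambda>v. indicator {..0} (v - t) * (\<phi> (v - t) * x v))"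
  have A: "integrable lborel A"
    using int_\<phi>[of 0] by (simp add: A_def set_integrable_def)
  have "set_integrable lborel {0..t} (\<lambda>v. \<phi> 0 * x v)"
    by (intro borel_integrable_atLeastAtMost' continuous_intros continuous_on_subset[OF cont_x]) auto
  then have B: "integrable lborel B"
    by (simp add: B_def set_integrable_def)
  have C_shift: "C (t + \<xi>) = indicator {..0} \<xi> * (\<phi> \<xi> * x (t + \<xi>))" for \<xi>
    by (simp add: C_def)
  have "integrable lborel (\<lambda>\<xi>. C (t + 1 * \<xi>))"
    using int_\<phi>[OF \<open>t \<ge> 0\<close>] by (simp add: C_shift set_integrable_def)
  then have C: "integrable lborel C"
    using lborel_integrable_real_affine_iff[of 1 C t] by simp
  \<comment> \<open>The supports of \<open>A\<close> and \<open>B\<close> share the point 0, which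
    is discarded as a null set.\<close>
  have "AE v in lborel. J v = A v + B v - C v"
    using AE_lborel_singleton[of 0]
  proof eventually_elim
    case (elim v)
    then show ?case
      using \<open>t \<ge> 0\<close> by (auto simp: J_eq A_def B_def C_def indicator_def min_def algebra_simps)
  qed
  then have "(\<integral>v. J v \<partial>lborel) = (\<integral>v. A v + B v - C v \<partial>lborel)"
    by (intro integral_cong_AE) (use J A B C in auto)
  also have "\<dots> = (\<integral>v. A v \<partial>lborel) + (\<integral>v. B v \<partial>lborel) - (\<integral>v. C v \<partial>lborel)"
    using A B C by simp
  finally have "(\<integral>v. J v \<partial>lborel) = (\<integral>v. A v \<partial>lborel) + (\<integral>v. B v \<partial>lborel) - (\<integral>v. C v \<partial>lborel)" .
  moreover have "(\<integral>v. J v \<partial>lborel) = (LINT r:{0..t}|lborel. LINT \<xi>:{..0}|lborel. \<psi> \<xi> * x (r + \<xi>))"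
    unfolding J_def lborel_pair.Fubini_integral[OF F'] F_inner by (simp add: set_lebesgue_integral_def)
  moreover have "(\<integral>v. A v \<partial>lborel) = (LINT \<xi>:{..0}|lborel. \<phi> \<xi> * x \<xi>)"
    by (simp add: A_def set_lebesgue_integral_def)
  moreover have "(\<integral>v. B v \<partial>lborel) = \<phi> 0 * (LINT r:{0..t}|lborel. x r)"
    by (simp add: B_def set_lebesgue_integral_def mult.left_commute)
  moreover have "(\<integral>v. C v \<partial>lborel) = (LINT \<xi>:{..0}|lborel. \<phi> \<xi> * x (t + \<xi>))"
    using lborel_integral_real_affine[of 1 C t] by (simp add: C_shift set_lebesgue_integral_def)
  ultimately show ?eq by simp
qed


section \<open>Orthonormal expansion and the operator \<open>A*\<close>\<close>

lemma zero_L2w [simp]: "(\<lambda>_. 0) \<in> L2w w"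
  by (simp add: L2w_def set_borel_measurable_def set_integrable_def)

lemma Hw_inner_eq_lincomb:
  assumes w: "weight w" and "finite I" and x: "x \<in> Hw w" and y: "y \<in> Hw w"
    and v: "\<And>i. i \<in> I \<Longrightarrow> v i \<in> Hw w" and eq: "Hw_eq x (Hw_lincomb I c v)"
  shows "Hw_inner w x y = (\<Sum>i\<in>I. c i * Hw_inner w (v i) y)"
proof -
  have L2: "snd x \<in> L2w w" "snd y \<in> L2w w" "\<And>i. i \<in> I \<Longrightarrow> snd (v i) \<in> L2w w"
    using x y v by (auto simp: Hw_def mem_Times_iff)
  let ?h = "\<lambda>i \<xi>. snd (v i) \<xi> * snd y \<xi> * w \<xi>"
  have int: "integrable lborel (\<lambda>\<xi>. indicator {..0} \<xi> * ?h i \<xi>)" if "i \<in> I" for i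
    using set_integrable_L2w_mult(1)[OF w L2(3)[OF that] L2(2)] by (simp add: set_integrable_def)
  then have int_sum: "integrable lborel (\<lambda>\<xi>. \<Sum>i\<in>I. c i * (indicator {..0} \<xi> * ?h i \<xi>))"
    by (intro Bochner_Integration.integrable_sum integrable_mult_right) auto
  have "L2w_inner w (snd x) (snd y) = (\<integral>\<xi>. (\<Sum>i\<in>I. c i * (indicator {..0} \<xi> * ?h i \<xi>)) \<partial>lborel)"
    unfolding L2w_inner_def set_lebesgue_integral_def
  proof (rule integral_cong_AE)
    have "AE \<xi> in lborel. \<xi> \<le> 0 \<longrightarrow> snd x \<xi> = (\<Sum>i\<in>I. c i * snd (v i) \<xi>)"
      using eq by (simp add: Hw_eq_def ae_eq_def Hw_lincomb_def)
    then show "AE \<xi> in lborel. indicator {..0} \<xi> *\<^sub>R (snd x \<xi> * snd y \<xi> * w \<xi>)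
        = (\<Sum>i\<in>I. c i * (indicator {..0} \<xi> * ?h i \<xi>))"
      by eventually_elim (auto simp: indicator_def sum_distrib_left sum_distrib_right mult_ac)
  qed (use L2w_mult_measurable[OF w L2(1,2)] int_sum in auto)
  also have "\<dots> = (\<Sum>i\<in>I. \<integral>\<xi>. c i * (indicator {..0} \<xi> * ?h i \<xi>) \<partial>lborel)"
    by (intro Bochner_Integration.integral_sum integrable_mult_right int)
  also have "\<dots> = (\<Sum>i\<in>I. c i * L2w_inner w (snd (v i)) (snd y))"
    by (simp add: L2w_inner_def set_lebesgue_integral_def)
  finally show ?thesis
    using eq by (simp add: Hw_inner_def Hw_eq_def Hw_lincomb_def sum_distrib_left sum_distrib_right
        distrib_left sum.distrib mult_ac)
qed

lemma Hw_inner_commute: "Hw_inner w x y = Hw_inner w y x"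
  by (simp add: Hw_inner_def L2w_inner_def mult.commute)

text \<open>Parseval with only \<open>x\<close> in \<open>V\<close>: the part of \<open>y\<close>
  orthogonal to \<open>V\<close> is invisible to \<open>x\<close>. This allows \<open>y\<close> to
  be the segment of the path, which need not lie in \<open>V\<close>.\<close>

lemma Hw_inner_orthonormal_expansion:
  assumes w: "weight w" and "finite I" and V: "V \<subseteq> Hw w"
    and basis: "Hw_orthonormal_basis w V I e" and x: "x \<in> V" and y: "y \<in> Hw w"
  shows "Hw_inner w x y = (\<Sum>k\<in>I. Hw_inner w (e k) x * Hw_inner w (e k) y)"
proof -
  obtain c where c: "Hw_eq x (Hw_lincomb I c e)"
    using basis x unfolding Hw_orthonormal_basis_def by blast
  have e: "e k \<in> Hw w" if "k \<in> I" for k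
    using basis that V unfolding Hw_orthonormal_basis_def by blast
  have x': "x \<in> Hw w" using x V by blast
  note expand = Hw_inner_eq_lincomb[OF w \<open>finite I\<close> x' _ e c]
  have "Hw_inner w (e k) x = c k" if "k \<in> I" for k
  proof -
    have "Hw_inner w (e k) x = (\<Sum>i\<in>I. c i * Hw_inner w (e i) (e k))"
      using expand[OF e[OF that]] by (simp add: Hw_inner_commute[of w "e k" x])
    also have "\<dots> = (\<Sum>i\<in>I. c i * (if i = k then 1 else 0))"
      using basis that by (intro sum.cong) (auto simp: Hw_orthonormal_basis_def)
    also have "\<dots> = c k"
      using \<open>finite I\<close> that by (simp add: if_distrib cong: if_cong)
    finally show ?thesis .
  qed
  then show ?thesis
    using expand[OF y] by simp
qed

lemma Hw_inner_e0:
  assumes "Hw_eq x e0"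
  shows "Hw_inner w x y = fst y"
proof -
  have "AE \<xi> in lborel. \<xi> \<le> 0 \<longrightarrow> snd x \<xi> = 0"
    using assms by (simp add: Hw_eq_def ae_eq_def e0_def)
  then have "AE \<xi> in lborel. indicator {..0} \<xi> *\<^sub>R (snd x \<xi> * snd y \<xi> * w \<xi>) = 0"
    by eventually_elim (simp add: indicator_def)
  then have "L2w_inner w (snd x) (snd y) = 0"
    unfolding L2w_inner_def set_lebesgue_integral_def by (rule integral_eq_zero_AE)
  with assms show ?thesis
    by (simp add: Hw_inner_def Hw_eq_def e0_def)
qed

text \<open>Membership in the domain guarantees that the choice inside \<open>Astar\<close> returns
  a genuine representative pair. Keeping that very pair avoids a uniqueness argument for weak
  derivatives.\<close>

lemma Astar_eq:
  assumes "x \<in> Astar_dom w"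
  obtains f g where "W12_rep w (snd x) f g"
    and "Astar w x = (f 0, \<lambda>\<xi>. - g \<xi> - f \<xi> * (wder w \<xi> / w \<xi>))"
proof -
  define p where "p = (SOME (f, g). W12_rep w (snd x) f g)"
  have "\<exists>p. case p of (f, g) \<Rightarrow> W12_rep w (snd x) f g"
    using assms by (auto simp: Astar_dom_def)
  then have "case p of (f, g) \<Rightarrow> W12_rep w (snd x) f g"
    unfolding p_def by (rule someI_ex)
  moreover have "Astar w x = (case p of (f, g) \<Rightarrow> (f 0, \<lambda>\<xi>. - g \<xi> - f \<xi> * (wder w \<xi> / w \<xi>)))"
    unfolding Astar_def p_def by simp
  ultimately show ?thesis
    using that by (cases p) auto
qed

text \<open>Tested integrals do not see null sets. This lets the chosen weak derivative, known only
  almost everywhere, be exchanged for a continuous function.\<close>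

lemma weak_derivative_cong_continuous:
  assumes weak: "weak_derivative f g" and g: "set_borel_measurable lborel {..0} g"
    and G: "continuous_on {..0} G" and eq: "ae_eq g G"
  shows "weak_derivative f G"
  unfolding weak_derivative_def
proof (intro allI impI)
  fix \<phi> \<phi>' :: "real \<Rightarrow> real"
  assume \<phi>: "(\<forall>x. (\<phi> has_real_derivative \<phi>' x) (at x)) \<and> continuous_on UNIV \<phi>' \<and>
    (\<exists>a b. b < 0 \<and> (\<forall>x. x \<notin> {a..b} \<longrightarrow> \<phi> x = 0))"
  then have "continuous_on UNIV \<phi>"
    by (auto intro!: continuous_at_imp_continuous_on DERIV_isCont)
  note [measurable] = borel_measurable_continuous_onI[OF this]
  have [measurable]: "(\<lambda>\<xi>. indicator {..0} \<xi> * g \<xi>) \<in> borel_measurable borel"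
    using g by (simp add: set_borel_measurable_def)
  have [measurable]: "(\<lambda>\<xi>. indicator {..0} \<xi> * G \<xi>) \<in> borel_measurable borel"
    using borel_measurable_continuous_on_indicator[OF _ G] by simp
  have "(LINT \<xi>:{..0}|lborel. g \<xi> * \<phi> \<xi>) = (\<integral>\<xi>. indicator {..0} \<xi> * g \<xi> * \<phi> \<xi> \<partial>lborel)"
    by (simp add: set_lebesgue_integral_def mult.assoc)
  also have "\<dots> = (\<integral>\<xi>. indicator {..0} \<xi> * G \<xi> * \<phi> \<xi> \<partial>lborel)"
  proof (rule integral_cong_AE)
    show "AE \<xi> in lborel. indicator {..0} \<xi> * g \<xi> * \<phi> \<xi> = indicator {..0} \<xi> * G \<xi> * \<phi> \<xi>"
      using eq unfolding ae_eq_def by eventually_elim (simp add: indicator_def)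
  qed measurable
  also have "\<dots> = (LINT \<xi>:{..0}|lborel. G \<xi> * \<phi> \<xi>)"
    by (simp add: set_lebesgue_integral_def mult.assoc)
  finally have "(LINT \<xi>:{..0}|lborel. g \<xi> * \<phi> \<xi>) = (LINT \<xi>:{..0}|lborel. G \<xi> * \<phi> \<xi>)" .
  with weak[unfolded weak_derivative_def, THEN spec, THEN spec, THEN mp, OF \<phi>]
  show "(LINT \<xi>:{..0}|lborel. f \<xi> * \<phi>' \<xi>) = - (LINT \<xi>:{..0}|lborel. G \<xi> * \<phi> \<xi>)"
    by simp
qed

text \<open>On a stable finite-dimensional space the weak derivative is a combination of continuous
  functions, so the Sobolev representatives solve a classical linear ODE; multiplying by the weight
  absorbs the term with \<open>w'/w\<close>.\<close>

lemma Astar_invariant_imp_derivative: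
  assumes w: "weight w" and rep: "W12_rep w h f g"
    and F: "\<And>i. i \<in> I \<Longrightarrow> continuous_on {..0} (F i)"
    and eq: "ae_eq (\<lambda>\<xi>. - g \<xi> - f \<xi> * (wder w \<xi> / w \<xi>)) (\<lambda>\<xi>. \<Sum>i\<in>I. c i * F i \<xi>)"
    and "\<xi> \<le> 0"
  shows "((\<lambda>\<xi>. f \<xi> * w \<xi>) has_real_derivative - (\<Sum>i\<in>I. c i * (F i \<xi> * w \<xi>))) (at \<xi> within {..0})"
proof -
  have f: "continuous_on {..0} f"
    using rep by (simp add: W12_rep_def locally_abs_cont_imp_continuous_on)
  define G where "G = (\<lambda>\<xi>. - (f \<xi> * (wder w \<xi> / w \<xi>)) - (\<Sum>i\<in>I. c i * F i \<xi>))"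
  have G: "continuous_on {..0} G"
    unfolding G_def
  proof (intro continuous_intros f F)
    show "continuous_on {..0} (wder w)" using w by (simp add: weight_def)
    show "\<forall>\<xi>\<in>{..0}. w \<xi> \<noteq> 0" using weight_pos[OF w] by force
  qed (use continuous_on_weight[OF w] in simp_all)
  have "ae_eq g G"
    using eq unfolding ae_eq_def by eventually_elim (auto simp: G_def)
  then have "weak_derivative f G"
    by (rule weak_derivative_cong_continuous[OF _ _ G, rotated 2]) (use rep in \<open>auto simp: W12_rep_def L2w_def\<close>)
  from DERIV_mult[OF weak_derivative_continuous_imp_derivative[OF f G this \<open>\<xi> \<le> 0\<close>]
      weight_has_derivative[OF w \<open>\<xi> \<le> 0\<close>]]
  have "((\<lambda>\<xi>. f \<xi> * w \<xi>) has_real_derivative G \<xi> * w \<xi> + wder w \<xi> * f \<xi>) (at \<xi> within {..0})" .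
  also have "G \<xi> * w \<xi> + wder w \<xi> * f \<xi> = - (\<Sum>i\<in>I. c i * (F i \<xi> * w \<xi>))"
    using weight_pos[OF w \<open>\<xi> \<le> 0\<close>] by (simp add: G_def left_diff_distrib sum_distrib_right mult.assoc)
  finally show ?thesis .
qed

text \<open>The Fubini identity is applied to \<open>f k * w\<close>. Its derivative
  \<open>\<psi>\<close> is minus a combination of the \<open>f h * w\<close>, so pairing
  \<open>\<psi>\<close> with the path reproduces the \<open>Y h\<close>, and the two minus signs
  cancel; \<open>w 0 = 1\<close> turns the boundary value into \<open>f k 0\<close>.\<close>

lemma delay_system_path:
  fixes w x :: "real \<Rightarrow> real" and f :: "'i \<Rightarrow> real \<Rightarrow> real"
  defines "Y \<equiv> \<lambda>h t. L2w_inner w (f h) (\<lambda>\<xi>. x (t + \<xi>))"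
  assumes w: "weight w" and s1: "s1 \<in> L2w w" "\<And>v. v < 0 \<Longrightarrow> x v = s1 v"
    and x: "continuous_on {0..} x"
    and "finite I" and k: "k \<in> I"
    and f: "\<And>h. h \<in> I \<Longrightarrow> f h \<in> L2w w" "\<And>h. h \<in> I \<Longrightarrow> continuous_on {..0} (f h)"
    and deriv: "\<And>\<xi>. \<xi> \<le> 0 \<Longrightarrow> ((\<lambda>\<xi>. f k \<xi> * w \<xi>) has_real_derivative - (\<Sum>h\<in>I. c h * (f h \<xi> * w \<xi>)))
      (at \<xi> within {..0})"
    and "t \<ge> 0"
  shows "set_integrable lborel {0..t} (\<lambda>r. f k 0 * x r + (\<Sum>h\<in>I. c h * Y h r))"
    and "Y k t = Y k 0 + (LINT r:{0..t}|lborel. f k 0 * x r + (\<Sum>h\<in>I. c h * Y h r))"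
proof -
  define \<psi> where "\<psi> = (\<lambda>\<xi>. - (\<Sum>h\<in>I. c h * (f h \<xi> * w \<xi>)))"
  have shift: "(\<lambda>\<xi>. x (r + \<xi>)) \<in> L2w w" if "r \<ge> 0" for r
    using delay_path_shift_L2w[OF w s1 x, of r] that by blast
  obtain N where N: "\<And>r. 0 \<le> r \<Longrightarrow> r \<le> t \<Longrightarrow> (LINT \<xi>:{..0}|lborel. (x (r + \<xi>))\<^sup>2 * w \<xi>) \<le> N"
    using delay_path_shift_L2w[OF w s1 x, of t] by blast
  have prod: "set_integrable lborel {..0} (\<lambda>\<xi>. f h \<xi> * x (r + \<xi>) * w \<xi>)" if "h \<in> I" "r \<ge> 0" for h r
    by (rule set_integrable_L2w_mult(1)[OF w f(1)[OF that(1)] shift[OF that(2)]])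
  have int_\<psi>: "set_integrable lborel {..0} (\<lambda>\<xi>. \<psi> \<xi> * x (r + \<xi>))"
    and Y_\<psi>: "(LINT \<xi>:{..0}|lborel. \<psi> \<xi> * x (r + \<xi>)) = - (\<Sum>h\<in>I. c h * Y h r)" if "r \<ge> 0" for r
  proof -
    have int: "integrable lborel (\<lambda>\<xi>. c h * (indicator {..0} \<xi> * (f h \<xi> * x (r + \<xi>) * w \<xi>)))" if "h \<in> I" for h
      using prod[OF that \<open>r \<ge> 0\<close>] by (simp add: set_integrable_def)
    have eq: "indicator {..0} \<xi> * (\<psi> \<xi> * x (r + \<xi>))
        = - (\<Sum>h\<in>I. c h * (indicator {..0} \<xi> * (f h \<xi> * x (r + \<xi>) * w \<xi>)))" for \<xi>
      by (simp add: \<psi>_def sum_distrib_left sum_distrib_right mult_ac)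
    show "set_integrable lborel {..0} (\<lambda>\<xi>. \<psi> \<xi> * x (r + \<xi>))"
      unfolding set_integrable_def real_scaleR_def eq
      by (intro integrable_minus Bochner_Integration.integrable_sum int)
    show "(LINT \<xi>:{..0}|lborel. \<psi> \<xi> * x (r + \<xi>)) = - (\<Sum>h\<in>I. c h * Y h r)"
      unfolding set_lebesgue_integral_def real_scaleR_def eq
      using int by (simp add: Bochner_Integration.integral_sum Y_def L2w_inner_def set_lebesgue_integral_def)
  qed
  \<comment> \<open>The uniform Fubini bound: each pairing is at most the squared norm of
    \<open>f h\<close> plus the bound \<open>N\<close> for the squared norms of the shifted paths on
    \<open>[0, t]\<close>.\<close>
  define B where "B = (\<Sum>h\<in>I. \<bar>c h\<bar> * ((LINT \<xi>:{..0}|lborel. (f h \<xi>)\<^sup>2 * w \<xi>) + N))"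
  have bound: "(LINT \<xi>:{..0}|lborel. \<bar>\<psi> \<xi> * x (r + \<xi>)\<bar>) \<le> B" if r: "0 \<le> r" "r \<le> t" for r
  proof -
    have int: "integrable lborel (\<lambda>\<xi>. \<bar>c h\<bar> * (indicator {..0} \<xi> * \<bar>f h \<xi> * x (r + \<xi>) * w \<xi>\<bar>))" if "h \<in> I" for h
      using set_integrable_abs[OF prod[OF that r(1)]] by (simp add: set_integrable_def)
    have "(LINT \<xi>:{..0}|lborel. \<bar>\<psi> \<xi> * x (r + \<xi>)\<bar>)
        \<le> (\<integral>\<xi>. (\<Sum>h\<in>I. \<bar>c h\<bar> * (indicator {..0} \<xi> * \<bar>f h \<xi> * x (r + \<xi>) * w \<xi>\<bar>)) \<partial>lborel)"
      unfolding set_lebesgue_integral_def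
    proof (rule integral_mono)
      show "integrable lborel (\<lambda>\<xi>. indicator {..0} \<xi> *\<^sub>R \<bar>\<psi> \<xi> * x (r + \<xi>)\<bar>)"
        using set_integrable_abs[OF int_\<psi>[OF r(1)]] by (simp add: set_integrable_def)
      show "integrable lborel (\<lambda>\<xi>. \<Sum>h\<in>I. \<bar>c h\<bar> * (indicator {..0} \<xi> * \<bar>f h \<xi> * x (r + \<xi>) * w \<xi>\<bar>))"
        by (intro Bochner_Integration.integrable_sum int)
      fix \<xi>
      have "\<psi> \<xi> * x (r + \<xi>) = - (\<Sum>h\<in>I. c h * (f h \<xi> * x (r + \<xi>) * w \<xi>))"
        by (simp add: \<psi>_def sum_distrib_left sum_distrib_right mult_ac)
      then have "\<bar>\<psi> \<xi> * x (r + \<xi>)\<bar> \<le> (\<Sum>h\<in>I. \<bar>c h * (f h \<xi> * x (r + \<xi>) * w \<xi>)\<bar>)"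
        by (simp add: sum_abs)
      then show "indicator {..0} \<xi> *\<^sub>R \<bar>\<psi> \<xi> * x (r + \<xi>)\<bar>
          \<le> (\<Sum>h\<in>I. \<bar>c h\<bar> * (indicator {..0} \<xi> * \<bar>f h \<xi> * x (r + \<xi>) * w \<xi>\<bar>))"
        by (simp add: indicator_def abs_mult)
    qed
    also have "\<dots> = (\<Sum>h\<in>I. \<bar>c h\<bar> * (LINT \<xi>:{..0}|lborel. \<bar>f h \<xi> * x (r + \<xi>) * w \<xi>\<bar>))"
      using int by (simp add: Bochner_Integration.integral_sum set_lebesgue_integral_def)
    also have "\<dots> \<le> B"
      unfolding B_def
    proof (intro sum_mono mult_left_mono)
      fix h assume "h \<in> I"
      then show "(LINT \<xi>:{..0}|lborel. \<bar>f h \<xi> * x (r + \<xi>) * w \<xi>\<bar>) \<le> (LINT \<xi>:{..0}|lborel. (f h \<xi>)\<^sup>2 * w \<xi>) + N"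
        using set_integrable_L2w_mult(2)[OF w f(1) shift[OF r(1)]] N[OF r] by fastforce
    qed simp
    finally show ?thesis .
  qed
  have cont_\<psi>: "continuous_on {..0} \<psi>"
    unfolding \<psi>_def by (intro continuous_intros f continuous_on_weight[OF w])
  have int_\<phi>: "set_integrable lborel {..0} (\<lambda>\<xi>. f k \<xi> * w \<xi> * x (r + \<xi>))" if "r \<ge> 0" for r
    using prod[OF k that] by (simp add: mult_ac)
  have deriv': "((\<lambda>\<xi>. f k \<xi> * w \<xi>) has_real_derivative \<psi> \<xi>) (at \<xi> within {..0})" if "\<xi> \<le> 0" for \<xi>
    using deriv[OF that] by (simp add: \<psi>_def)
  have meas: "x \<in> borel_measurable borel"
    using s1 x by (rule delay_path_measurable)
  note fubini = delay_pairing_integral[OF deriv' cont_\<psi> meas x \<open>t \<ge> 0\<close> int_\<phi> int_\<psi> bound]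
  have cong: "(LINT r:{0..t}|lborel. LINT \<xi>:{..0}|lborel. \<psi> \<xi> * x (r + \<xi>))
      = (LINT r:{0..t}|lborel. - (\<Sum>h\<in>I. c h * Y h r))"
    by (rule set_lebesgue_integral_cong) (auto simp: Y_\<psi>)
  have "set_integrable lborel {0..t} (\<lambda>r. LINT \<xi>:{..0}|lborel. \<psi> \<xi> * x (r + \<xi>))
    \<longleftrightarrow> set_integrable lborel {0..t} (\<lambda>r. - (\<Sum>h\<in>I. c h * Y h r))"
    by (rule set_integrable_cong) (auto simp: Y_\<psi>)
  then have int1: "set_integrable lborel {0..t} (\<lambda>r. \<Sum>h\<in>I. c h * Y h r)"
    using fubini(1) by (simp add: set_integrable_def)
  have int2: "set_integrable lborel {0..t} (\<lambda>r. f k 0 * x r)"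
    by (intro borel_integrable_atLeastAtMost' continuous_intros continuous_on_subset[OF x]) auto
  show "set_integrable lborel {0..t} (\<lambda>r. f k 0 * x r + (\<Sum>h\<in>I. c h * Y h r))"
    by (rule set_integral_add(1)[OF int2 int1])
  have "Y k r = (LINT \<xi>:{..0}|lborel. f k \<xi> * w \<xi> * x (r + \<xi>))" for r
    by (simp add: Y_def L2w_inner_def mult_ac)
  moreover have "w 0 = 1" using w by (simp add: weight_def)
  ultimately show "Y k t = Y k 0 + (LINT r:{0..t}|lborel. f k 0 * x r + (\<Sum>h\<in>I. c h * Y h r))"
    using fubini(2) cong
    by (simp add: set_integral_add(2)[OF int2 int1]) (simp add: set_lebesgue_integral_def)
qed


section \<open>The finite-dimensional system\<close>

text \<open>The functional at time \<open>t\<close> reads the path on \<open>[0, t]\<close> and a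
  deterministic past. Its integrand is jointly measurable for the time-\<open>t\<close> filtration,
  and integrating out \<open>\<xi>\<close> preserves measurability in
  \<open>\<omega>\<close>.\<close>

lemma borel_measurable_delay_functional:
  assumes w: "weight w" and h: "h \<in> L2w w" and s1: "s1 \<in> L2w w"
    and past: "\<And>\<omega> v. \<omega> \<in> space M \<Longrightarrow> v < 0 \<Longrightarrow> S v \<omega> = s1 v"
    and meas: "\<And>r. r \<ge> 0 \<Longrightarrow> S r \<in> borel_measurable (brownian_filtration M W r)"
    and cont: "\<And>\<omega>. \<omega> \<in> space M \<Longrightarrow> continuous_on {0..} (\<lambda>r. S r \<omega>)"
    and "t \<ge> 0"
  shows "(\<lambda>\<omega>. L2w_inner w h (\<lambda>\<xi>. S (t + \<xi>) \<omega>)) \<in> borel_measurable (brownian_filtration M W t)"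
proof -
  let ?N = "brownian_filtration M W t"
  note [measurable] = L2w_measurable[OF h] L2w_measurable[OF s1] weight_measurable[OF w]
  \<comment> \<open>Clamping time to \<open>[0, t]\<close> makes every \<open>Y r\<close> measurable
    at time \<open>t\<close> while keeping the paths continuous on the whole line.\<close>
  define Y where "Y = (\<lambda>r \<omega>. S (max 0 (min t r)) \<omega>)"
  have "(\<lambda>(r, \<omega>). Y r \<omega>) \<in> borel_measurable (borel \<Otimes>\<^sub>M ?N)"
  proof (rule borel_measurable_continuous_process)
    show "Y r \<in> borel_measurable ?N" for r
      unfolding Y_def by (rule measurable_brownian_filtration_mono[OF meas]) (use \<open>t \<ge> 0\<close> in auto)
    show "continuous_on UNIV (\<lambda>r. Y r \<omega>)" if "\<omega> \<in> space ?N" for \<omega>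
      unfolding Y_def using that
      by (intro continuous_on_compose2[OF cont]) (auto intro!: continuous_intros)
  qed
  moreover have "(\<lambda>p. (t + snd p, fst p)) \<in> measurable (?N \<Otimes>\<^sub>M lborel) (borel \<Otimes>\<^sub>M ?N)"
    by measurable
  ultimately have "(\<lambda>p. case (t + snd p, fst p) of (r, \<omega>) \<Rightarrow> Y r \<omega>) \<in> borel_measurable (?N \<Otimes>\<^sub>M lborel)"
    by (rule measurable_compose[rotated])
  then have [measurable]: "(\<lambda>p. Y (t + snd p) (fst p)) \<in> borel_measurable (?N \<Otimes>\<^sub>M lborel)"
    by simp
  define Q where "Q = (\<lambda>\<omega> \<xi>. indicator {..0} \<xi> * h \<xi> *
    (if t + \<xi> < 0 then indicator {..0} (t + \<xi>) * s1 (t + \<xi>) else Y (t + \<xi>) \<omega>) * w (min \<xi> 0))"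
  have "case_prod Q \<in> borel_measurable (?N \<Otimes>\<^sub>M lborel)"
    unfolding Q_def case_prod_beta' by measurable
  then have "(\<lambda>\<omega>. \<integral>\<xi>. Q \<omega> \<xi> \<partial>lborel) \<in> borel_measurable ?N"
    by (rule lborel.borel_measurable_lebesgue_integral)
  moreover have "(\<integral>\<xi>. Q \<omega> \<xi> \<partial>lborel) = L2w_inner w h (\<lambda>\<xi>. S (t + \<xi>) \<omega>)" if "\<omega> \<in> space ?N" for \<omega>
    unfolding L2w_inner_def set_lebesgue_integral_def
  proof (rule Bochner_Integration.integral_cong)
    fix \<xi> :: real
    have "Y (t + \<xi>) \<omega> = S (t + \<xi>) \<omega>" if "\<xi> \<le> 0" "\<not> t + \<xi> < 0"
      using that by (simp add: Y_def)
    then show "Q \<omega> \<xi> = indicator {..0} \<xi> *\<^sub>R (h \<xi> * S (t + \<xi>) \<omega> * w \<xi>)"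
      using past[of \<omega> "t + \<xi>"] that by (auto simp: Q_def indicator_def min_absorb1)
  qed simp
  ultimately show ?thesis
    by (subst measurable_cong[symmetric]) auto
qed

lemma continuous_on_indefinite_set_integral:
  fixes B :: "real \<Rightarrow> real"
  assumes B: "\<And>T. T \<ge> 0 \<Longrightarrow> set_integrable lborel {0..T} B"
  shows "continuous_on {0..} (\<lambda>t. LINT s:{0..t}|lborel. B s)"
  unfolding continuous_on_eq_continuous_within
proof
  fix t :: real assume t: "t \<in> {0..}"
  have "continuous_on {0..t + 1} (\<lambda>t. integral {0..t} B)"
    using t by (intro indefinite_integral_continuous_1 set_borel_integral_eq_integral(1) B) auto
  moreover have "continuous_on {0..t + 1} (\<lambda>t. integral {0..t} B)
      \<longleftrightarrow> continuous_on {0..t + 1} (\<lambda>t. LINT s:{0..t}|lborel. B s)"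
    by (rule continuous_on_cong) (auto simp: set_borel_integral_eq_integral(2)[OF B])
  ultimately have "continuous_on {0..t + 1} (\<lambda>t. LINT s:{0..t}|lborel. B s)"
    by simp
  then have "continuous (at t within {0..t + 1}) (\<lambda>t. LINT s:{0..t}|lborel. B s)"
    using t by (simp add: continuous_on_eq_continuous_within)
  \<comment> \<open>Continuity at \<open>t\<close> is local; the margin \<open>t + 1\<close> ensures
    that the compact interval contains a relative neighbourhood of \<open>t\<close>.\<close>
  moreover have "at t within {0..} = at t within {0..t + 1}"
    by (rule at_within_nhd[of t "{..<t + 1}"]) auto
  ultimately show "continuous (at t within {0..}) (\<lambda>t. LINT s:{0..t}|lborel. B s)"
    by simp
qed

text \<open>The zero process is the witness for the Ito integral, so the differential reduces to a
  pathwise integral equation with a continuous adapted drift.\<close>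

lemma has_ito_differential_absolutely_continuous:
  assumes W: "brownian_motion M W"
    and X: "\<And>t. t \<ge> 0 \<Longrightarrow> X t \<in> borel_measurable (brownian_filtration M W t)"
      "\<And>\<omega>. \<omega> \<in> space M \<Longrightarrow> continuous_on {0..} (\<lambda>t. X t \<omega>)"
    and B: "\<And>t. t \<ge> 0 \<Longrightarrow> B t \<in> borel_measurable (brownian_filtration M W t)"
      "\<And>\<omega>. \<omega> \<in> space M \<Longrightarrow> continuous_on {0..} (\<lambda>t. B t \<omega>)"
    and eq: "\<And>\<omega> t. \<omega> \<in> space M \<Longrightarrow> t \<ge> 0 \<Longrightarrow> X t \<omega> = X 0 \<omega> + (LINT s:{0..t}|lborel. B s \<omega>)"
  shows "has_ito_differential M W X B (\<lambda>t \<omega>. 0)"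
  unfolding has_ito_differential_def
proof (intro conjI allI impI ballI exI)
  show "measurable_adapted M W B"
    using W B by (rule measurable_adapted_continuous)
  have "set_integrable lborel {0..T} (\<lambda>t. B t \<omega>)" if "\<omega> \<in> space M" for T \<omega>
    by (intro borel_integrable_atLeastAtMost' continuous_on_subset[OF B(2)[OF that]]) auto
  then show "AE \<omega> in M. \<forall>T\<ge>0. set_integrable lborel {0..T} (\<lambda>t. B t \<omega>)"
    by (intro AE_I2) auto
  show "is_ito_integral M W (\<lambda>t \<omega>. 0) (\<lambda>t \<omega>. 0)"
    by (rule is_ito_integral_zero)
  show "AE \<omega> in M. \<forall>t\<ge>0. X t \<omega> = X 0 \<omega> + (LINT s:{0..t}|lborel. B s \<omega>) + 0"
  proof (intro AE_I2 allI impI)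
    fix \<omega> t assume "\<omega> \<in> space M" "0 \<le> (t::real)"
    from eq[OF this] show "X t \<omega> = X 0 \<omega> + (LINT s:{0..t}|lborel. B s \<omega>) + 0"
      by simp
  qed
qed (use X in auto)

theorem mainTheorem1:
  fixes M :: "'a measure" and W :: "real \<Rightarrow> 'a \<Rightarrow> real"
    and w :: "real \<Rightarrow> real"
    and U :: "(real ^ 'd) set"
    and b \<sigma> :: "real \<Rightarrow> real \<Rightarrow> real ^ 'd \<Rightarrow> real"
    and \<alpha>1 \<beta>1 \<gamma>1 :: "real \<Rightarrow> real" and \<gamma>0 :: real
    and n :: nat and V :: "hw set" and e :: "nat \<Rightarrow> hw" and q :: "nat \<Rightarrow> nat \<Rightarrow> real"
    and s :: hw and u :: "real \<Rightarrow> 'a \<Rightarrow> real ^ 'd"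
    and S Z :: "real \<Rightarrow> 'a \<Rightarrow> real" and X :: "nat \<Rightarrow> real \<Rightarrow> 'a \<Rightarrow> real"
    and \<alpha> \<beta> \<gamma> :: "nat \<Rightarrow> real"
  assumes "prob_space M" and "complete_measure M" and "brownian_motion M W"
    and "weight w" and "coefficients U b \<sigma>"
    and "\<alpha>1 \<in> L2w w" and "\<beta>1 \<in> L2w w" and "\<gamma>1 \<in> L2w w"
    and "n \<ge> 1"
    and "Hw_subspace w V" and "Hw_has_dim V (n + 1)" and "Astar_stable w V" and "e0 \<in> V"
    and "Hw_eq (e 0) e0" and "Hw_orthonormal_basis w V {0..n} e"
    and "\<And>k. k \<in> {1..n} \<Longrightarrow> Hw_eq (Astar w (e k)) (Hw_lincomb {0..n} (q k) e)"
    and "(0, \<alpha>1) \<in> V" and "(0, \<beta>1) \<in> V"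
    and "s \<in> Hw w" and "control_process M W U u"
    and "delay_solution M W w b \<sigma> \<alpha>1 \<beta>1 s u S"
    and "\<And>t \<omega>. Z t \<omega> = \<gamma>0 * S t \<omega> + (LINT \<xi>:{..0}|lborel. \<gamma>1 \<xi> * S (t + \<xi>) \<omega> * w \<xi>)"
    and "\<And>k t \<omega>. X k t \<omega> = Hw_inner w (e k) (segment S t \<omega>)"
    and "\<And>k. \<alpha> k = Hw_inner w (e k) (0, \<alpha>1)"
    and "\<And>k. \<beta> k = Hw_inner w (e k) (0, \<beta>1)"
    and "\<And>k. \<gamma> k = Hw_inner w (e k) (\<gamma>0, \<gamma>1)"
  shows "(\<forall>t\<ge>0. \<forall>\<omega>\<in>space M. X 0 t \<omega> = S t \<omega>)
    \<and> has_ito_differential M W (X 0)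
        (\<lambda>t \<omega>. b (X 0 t \<omega>) (\<Sum>k=1..n. \<alpha> k * X k t \<omega>) (u t \<omega>))
        (\<lambda>t \<omega>. \<sigma> (X 0 t \<omega>) (\<Sum>k=1..n. \<beta> k * X k t \<omega>) (u t \<omega>))
    \<and> (\<forall>k\<in>{1..n}. has_ito_differential M W (X k)
        (\<lambda>t \<omega>. q k 0 * X 0 t \<omega> + (\<Sum>h=1..n. q k h * X h t \<omega>)) (\<lambda>t \<omega>. 0))
    \<and> (\<forall>k\<in>{0..n}. \<forall>\<omega>\<in>space M. X k 0 \<omega> = Hw_inner w (e k) s)
    \<and> ((\<gamma>0, \<gamma>1) \<in> V \<longrightarrow> (\<forall>t\<ge>0. \<forall>\<omega>\<in>space M. Z t \<omega> = (\<Sum>k=0..n. \<gamma> k * X k t \<omega>)))"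
proof -
  note W = assms(3) and w = assms(4) and stable = assms(12) and e_0 = assms(14) and basis = assms(15)
    and Astar_e = assms(16) and X_def = assms(23)

  \<comment> \<open>Path data and orthonormal expansion of the delay terms\<close>
  have V: "V \<subseteq> Hw w" using assms(10) by (simp add: Hw_subspace_def)
  have e_V: "e k \<in> V" if "k \<in> {0..n}" for k
    using basis that by (simp add: Hw_orthonormal_basis_def)
  have e_Hw: "e k \<in> Hw w" if "k \<in> {0..n}" for k
    using e_V[OF that] V by blast
  have e_L2: "snd (e k) \<in> L2w w" if "k \<in> {0..n}" for k
    using e_Hw[OF that] by (simp add: Hw_def mem_Times_iff)
  have s1: "snd s \<in> L2w w" using assms(19) by (simp add: Hw_def mem_Times_iff)
  have S_ito: "has_ito_differential M W S
       (\<lambda>t \<omega>. b (S t \<omega>) (LINT \<xi>:{..0}|lborel. \<alpha>1 \<xi> * S (t + \<xi>) \<omega> * w \<xi>) (u t \<omega>))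
       (\<lambda>t \<omega>. \<sigma> (S t \<omega>) (LINT \<xi>:{..0}|lborel. \<beta>1 \<xi> * S (t + \<xi>) \<omega> * w \<xi>) (u t \<omega>))"
    and S_0: "\<And>\<omega>. \<omega> \<in> space M \<Longrightarrow> S 0 \<omega> = fst s"
    and S_past: "\<And>\<omega> v. \<omega> \<in> space M \<Longrightarrow> v < 0 \<Longrightarrow> S v \<omega> = snd s v"
    using assms(21) by (auto simp: delay_solution_def)
  have S_meas: "\<And>t. t \<ge> 0 \<Longrightarrow> S t \<in> borel_measurable (brownian_filtration M W t)"
    and S_cont: "\<And>\<omega>. \<omega> \<in> space M \<Longrightarrow> continuous_on {0..} (\<lambda>t. S t \<omega>)"
    using S_ito by (auto simp: has_ito_differential_def)
  have shift: "(\<lambda>\<xi>. S (t + \<xi>) \<omega>) \<in> L2w w" if "t \<ge> 0" "\<omega> \<in> space M" for t \<omega>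
    using delay_path_shift_L2w[OF w s1 S_past[OF that(2)] S_cont[OF that(2)], of t] that(1) by blast
  have segment_Hw: "segment S t \<omega> \<in> Hw w" if "t \<ge> 0" "\<omega> \<in> space M" for t \<omega>
    using shift[OF that] by (simp add: segment_def Hw_def)
  have inner_e0: "Hw_inner w (e 0) y = fst y" for y
    by (rule Hw_inner_e0[OF e_0])
  have X_0: "X 0 t \<omega> = S t \<omega>" for t \<omega>
    by (simp add: X_def inner_e0 segment_def)
  have expand: "Hw_inner w y (segment S t \<omega>) = (\<Sum>k=0..n. Hw_inner w (e k) y * X k t \<omega>)"
    if "y \<in> V" "t \<ge> 0" "\<omega> \<in> space M" for y t \<omega>
    unfolding X_def by (rule Hw_inner_orthonormal_expansion[OF w _ V basis that(1) segment_Hw[OF that(2,3)]]) simp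
  \<comment> \<open>The sum starts at 1 because the coefficient on \<open>e 0\<close> is the first
    component of \<open>(0, a)\<close>.\<close>
  have expand_past: "(LINT \<xi>:{..0}|lborel. a \<xi> * S (t + \<xi>) \<omega> * w \<xi>)
      = (\<Sum>k=1..n. Hw_inner w (e k) (0, a) * X k t \<omega>)"
    if "(0, a) \<in> V" "t \<ge> 0" "\<omega> \<in> space M" for a t \<omega>
    using expand[OF that] by (simp add: Hw_inner_def[of w "(0, a)"] L2w_inner_def segment_def
        sum.atLeast_Suc_atMost inner_e0)

  \<comment> \<open>Basis relations for the Sobolev representatives\<close>
  have fst_e: "fst (e k) = 0" if "k \<in> {1..n}" for k
  proof -
    \<comment> \<open>Pairing with \<open>e 0\<close> reads off the first component, so
      orthogonality says precisely that this component vanishes.\<close>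
    have "Hw_inner w (e 0) (e k) = 0"
      using basis that by (auto simp: Hw_orthonormal_basis_def)
    then show ?thesis by (simp add: inner_e0)
  qed
  have "\<exists>f g. W12_rep w (snd (e k)) f g \<and> Astar w (e k) = (f 0, \<lambda>\<xi>. - g \<xi> - f \<xi> * (wder w \<xi> / w \<xi>))"
    if "k \<in> {1..n}" for k
  proof -
    have "e k \<in> Astar_dom w"
      using e_V[of k] that stable by (auto simp: Astar_stable_def)
    then show ?thesis by (rule Astar_eq) blast
  qed
  then obtain f g where rep: "\<And>k. k \<in> {1..n} \<Longrightarrow> W12_rep w (snd (e k)) (f k) (g k)"
    and Astar_rep: "\<And>k. k \<in> {1..n} \<Longrightarrow>
      Astar w (e k) = (f k 0, \<lambda>\<xi>. - g k \<xi> - f k \<xi> * (wder w \<xi> / w \<xi>))"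
    by metis
  have f_ae: "ae_eq (snd (e k)) (f k)" and f_L2: "f k \<in> L2w w" and f_cont: "continuous_on {..0} (f k)"
    if "k \<in> {1..n}" for k
    using rep[OF that] by (auto simp: W12_rep_def intro: locally_abs_cont_imp_continuous_on)
  have e0_snd: "AE \<xi> in lborel. \<xi> \<le> 0 \<longrightarrow> snd (e 0) \<xi> = 0" and e0_fst: "fst (e 0) = 1"
    using e_0 by (simp_all add: Hw_eq_def ae_eq_def e0_def)
  \<comment> \<open>First component of the basis relation: among the basis vectors only
    \<open>e 0\<close> has a nonzero one.\<close>
  have f_0: "f k 0 = q k 0" if "k \<in> {1..n}" for k
  proof -
    have "f k 0 = (\<Sum>h=0..n. q k h * fst (e h))"
      using Astar_e[OF that] by (simp add: Hw_eq_def Hw_lincomb_def Astar_rep[OF that])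
    also have "\<dots> = q k 0"
      by (simp add: sum.atLeast_Suc_atMost e0_fst fst_e)
    finally show ?thesis .
  qed
  \<comment> \<open>Second component of the basis relation: \<open>e 0\<close> drops out, and the
    finitely many \<open>e h\<close> are replaced by their continuous versions off one common null
    set.\<close>
  have Astar_ae: "ae_eq (\<lambda>\<xi>. - g k \<xi> - f k \<xi> * (wder w \<xi> / w \<xi>)) (\<lambda>\<xi>. \<Sum>h=1..n. q k h * f h \<xi>)"
    if "k \<in> {1..n}" for k
  proof -
    have "AE \<xi> in lborel. \<xi> \<le> 0 \<longrightarrow> - g k \<xi> - f k \<xi> * (wder w \<xi> / w \<xi>) = (\<Sum>h=0..n. q k h * snd (e h) \<xi>)"
      using Astar_e[OF that] by (simp add: Hw_eq_def ae_eq_def Hw_lincomb_def Astar_rep[OF that])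
    moreover have "AE \<xi> in lborel. \<forall>h\<in>{1..n}. \<xi> \<le> 0 \<longrightarrow> snd (e h) \<xi> = f h \<xi>"
      using f_ae by (intro AE_ball_countable') (auto simp: ae_eq_def)
    ultimately show ?thesis
      using e0_snd unfolding ae_eq_def
    proof eventually_elim
      case (elim \<xi>)
      then show ?case
        by (auto simp: sum.atLeast_Suc_atMost intro!: sum.cong)
    qed
  qed
  have deriv: "((\<lambda>\<xi>. f k \<xi> * w \<xi>) has_real_derivative - (\<Sum>h=1..n. q k h * (f h \<xi> * w \<xi>))) (at \<xi> within {..0})"
    if "k \<in> {1..n}" "\<xi> \<le> 0" for k \<xi>
    by (rule Astar_invariant_imp_derivative[OF w rep[OF that(1)] f_cont Astar_ae[OF that(1)] that(2)])
  have X_f: "X k t \<omega> = L2w_inner w (f k) (\<lambda>\<xi>. S (t + \<xi>) \<omega>)"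
    if "k \<in> {1..n}" "t \<ge> 0" "\<omega> \<in> space M" for k t \<omega>
  proof -
    have "k \<in> {0..n}" using that(1) by simp
    moreover have "ae_eq (\<lambda>\<xi>. S (t + \<xi>) \<omega>) (\<lambda>\<xi>. S (t + \<xi>) \<omega>)"
      by (simp add: ae_eq_def)
    ultimately have "L2w_inner w (snd (e k)) (\<lambda>\<xi>. S (t + \<xi>) \<omega>) = L2w_inner w (f k) (\<lambda>\<xi>. S (t + \<xi>) \<omega>)"
      by (intro L2w_inner_cong[OF w] e_L2 f_L2 f_ae shift that)
    then show ?thesis
      by (simp add: X_def Hw_inner_def segment_def fst_e[OF that(1)])
  qed

  \<comment> \<open>Pathwise integral equations, continuity and adaptedness of the
    components\<close>
  have X_path: "set_integrable lborel {0..t} (\<lambda>r. q k 0 * X 0 r \<omega> + (\<Sum>h=1..n. q k h * X h r \<omega>))"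
      "X k t \<omega> = X k 0 \<omega> + (LINT r:{0..t}|lborel. q k 0 * X 0 r \<omega> + (\<Sum>h=1..n. q k h * X h r \<omega>))"
    if "k \<in> {1..n}" "t \<ge> 0" "\<omega> \<in> space M" for k t \<omega>
  proof -
    note path = delay_system_path[where x = "\<lambda>v. S v \<omega>" and f = f and c = "q k", OF w s1 S_past[OF that(3)]
        S_cont[OF that(3)] finite_atLeastAtMost that(1) f_L2 f_cont deriv[OF that(1)] that(2)]
    have cong: "f k 0 * S r \<omega> + (\<Sum>h=1..n. q k h * L2w_inner w (f h) (\<lambda>\<xi>. S (r + \<xi>) \<omega>))
        = q k 0 * X 0 r \<omega> + (\<Sum>h=1..n. q k h * X h r \<omega>)" if "r \<in> {0..t}" for r
      using that \<open>k \<in> {1..n}\<close> \<open>\<omega> \<in> space M\<close> by (simp add: f_0 X_0 X_f)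
    show "set_integrable lborel {0..t} (\<lambda>r. q k 0 * X 0 r \<omega> + (\<Sum>h=1..n. q k h * X h r \<omega>))"
      using path(1) by (rule set_integrable_cong[THEN iffD1, rotated 3]) (use cong in auto)
    have "(LINT r:{0..t}|lborel. f k 0 * S r \<omega> + (\<Sum>h=1..n. q k h * L2w_inner w (f h) (\<lambda>\<xi>. S (r + \<xi>) \<omega>)))
        = (LINT r:{0..t}|lborel. q k 0 * X 0 r \<omega> + (\<Sum>h=1..n. q k h * X h r \<omega>))"
      by (rule set_lebesgue_integral_cong) (use cong in auto)
    then show "X k t \<omega> = X k 0 \<omega> + (LINT r:{0..t}|lborel. q k 0 * X 0 r \<omega> + (\<Sum>h=1..n. q k h * X h r \<omega>))"
      using path(2) that by (simp add: X_f)
  qed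
  have X_cont: "continuous_on {0..} (\<lambda>t. X k t \<omega>)" if "k \<in> {0..n}" "\<omega> \<in> space M" for k \<omega>
  proof (cases "k = 0")
    case True
    then show ?thesis using S_cont[OF that(2)] by (simp add: X_0)
  next
    case False
    then have k: "k \<in> {1..n}" using that by simp
    let ?B = "\<lambda>r. q k 0 * X 0 r \<omega> + (\<Sum>h=1..n. q k h * X h r \<omega>)"
    \<comment> \<open>Continuity is read off the integral equation. This is not circular:
      integrability of the drift came from Fubini, not from continuity of the components.\<close>
    have "continuous_on {0..} (\<lambda>t. X k t \<omega>)
        \<longleftrightarrow> continuous_on {0..} (\<lambda>t. X k 0 \<omega> + (LINT r:{0..t}|lborel. ?B r))"
      by (rule continuous_on_cong[OF refl], rule X_path(2)[OF k _ that(2)]) simp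
    moreover have "continuous_on {0..} (\<lambda>t. X k 0 \<omega> + (LINT r:{0..t}|lborel. ?B r))"
      by (intro continuous_intros continuous_on_indefinite_set_integral X_path(1)[OF k _ that(2)])
    ultimately show ?thesis by simp
  qed
  have X_meas: "X k t \<in> borel_measurable (brownian_filtration M W t)" if "k \<in> {0..n}" "t \<ge> 0" for k t
  proof -
    have "(\<lambda>\<omega>. fst (e k) * S t \<omega> + L2w_inner w (snd (e k)) (\<lambda>\<xi>. S (t + \<xi>) \<omega>))
        \<in> borel_measurable (brownian_filtration M W t)"
      using S_meas[OF that(2)] borel_measurable_delay_functional[OF w e_L2[OF that(1)] s1 S_past S_meas S_cont that(2)]
      by (intro borel_measurable_add borel_measurable_times borel_measurable_const)
    then show ?thesis
      by (simp add: X_def[abs_def] Hw_inner_def segment_def)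
  qed

  \<comment> \<open>The five claims of the theorem\<close>
  have "has_ito_differential M W (X 0)
        (\<lambda>t \<omega>. b (X 0 t \<omega>) (\<Sum>k=1..n. \<alpha> k * X k t \<omega>) (u t \<omega>))
        (\<lambda>t \<omega>. \<sigma> (X 0 t \<omega>) (\<Sum>k=1..n. \<beta> k * X k t \<omega>) (u t \<omega>))"
  proof -
    \<comment> \<open>An equality of functions on all times and all \<open>\<omega>\<close>: pairing
      with \<open>e 0\<close> returns the first component of any pair, whether or not it lies in
      \<open>Hw w\<close>.\<close>
    have "X 0 = S" by (simp add: X_0 fun_eq_iff)
    moreover have "has_ito_differential M W S
        (\<lambda>t \<omega>. b (X 0 t \<omega>) (\<Sum>k=1..n. \<alpha> k * X k t \<omega>) (u t \<omega>))
        (\<lambda>t \<omega>. \<sigma> (X 0 t \<omega>) (\<Sum>k=1..n. \<beta> k * X k t \<omega>) (u t \<omega>))"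
      using S_ito
      by (rule has_ito_differential_cong_coefficients)
         (simp_all add: X_0 expand_past assms(17,18,24,25))
    ultimately show ?thesis by simp
  qed
  moreover have "has_ito_differential M W (X k)
        (\<lambda>t \<omega>. q k 0 * X 0 t \<omega> + (\<Sum>h=1..n. q k h * X h t \<omega>)) (\<lambda>t \<omega>. 0)" if k: "k \<in> {1..n}" for k
  proof (rule has_ito_differential_absolutely_continuous[OF W])
    show "(\<lambda>\<omega>. q k 0 * X 0 t \<omega> + (\<Sum>h=1..n. q k h * X h t \<omega>)) \<in> borel_measurable (brownian_filtration M W t)"
      if "t \<ge> 0" for t
      using that by (intro borel_measurable_add borel_measurable_sum borel_measurable_times borel_measurable_const X_meas) auto
    show "continuous_on {0..} (\<lambda>t. q k 0 * X 0 t \<omega> + (\<Sum>h=1..n. q k h * X h t \<omega>))" if "\<omega> \<in> space M" for \<omega>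
      using that by (intro continuous_intros X_cont) auto
    show "X k t \<omega> = X k 0 \<omega> + (LINT r:{0..t}|lborel. q k 0 * X 0 r \<omega> + (\<Sum>h=1..n. q k h * X h r \<omega>))"
      if "\<omega> \<in> space M" "t \<ge> 0" for t \<omega>
      by (rule X_path(2)[OF k that(2,1)])
  qed (use k X_meas X_cont in auto)
  moreover have "X k 0 \<omega> = Hw_inner w (e k) s" if "k \<in> {0..n}" "\<omega> \<in> space M" for k \<omega>
  proof -
    \<comment> \<open>At \<open>\<xi> = 0\<close> the path takes the value \<open>fst s\<close>,
      which may differ from \<open>snd s 0\<close>; this single point is a null set.\<close>
    have "ae_eq (\<lambda>\<xi>. S (0 + \<xi>) \<omega>) (snd s)"
      using AE_lborel_singleton[of "0::real"] unfolding ae_eq_def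
      by eventually_elim (use S_past[OF that(2)] in auto)
    moreover have "ae_eq (snd (e k)) (snd (e k))"
      by (simp add: ae_eq_def)
    ultimately have "L2w_inner w (snd (e k)) (\<lambda>\<xi>. S (0 + \<xi>) \<omega>) = L2w_inner w (snd (e k)) (snd s)"
      using L2w_inner_cong[OF w e_L2[OF that(1)] e_L2[OF that(1)] shift[OF _ that(2)] s1] by blast
    then show ?thesis
      using S_0[OF that(2)] by (simp add: X_def Hw_inner_def segment_def)
  qed
  \<comment> \<open>\<open>Z\<close> is the pairing of \<open>(\<gamma>0, \<gamma>1)\<close> with
    the segment, so the expansion applies directly, now including \<open>k = 0\<close> because the
    first component may be nonzero.\<close>
  moreover have "Z t \<omega> = (\<Sum>k=0..n. \<gamma> k * X k t \<omega>)" if "(\<gamma>0, \<gamma>1) \<in> V" "t \<ge> 0" "\<omega> \<in> space M" for t \<omega>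
    using expand[OF that] by (simp add: assms(22,26) Hw_inner_def[of w "(\<gamma>0, \<gamma>1)"] L2w_inner_def segment_def)
  ultimately show ?thesis
    using X_0 by blast
qed

end
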